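(* Let $T$ be a locally finite tree. If $T$ has a parabolic embedding, then $Sib(T)=\infty$, unless $T$ is a ray.
   Context: Trees are connected acyclic simple graphs; an embedding of $T$ is an injective adjacency-preserving map from $T$ to itself. Two trees are siblings if each embeds into the other; $Sib(T)$ is the number of isomorphism classes of siblings of $T$. A ray is a one-way infinite path. Two rays are equivalent if their intersection is a ray; the equivalence classes are the ends. An embedding fixes an end $\eta$ if it maps rays of $\eta$ to rays of $\eta$. An embedding is elliptic if it maps some non-empty finite subtree onto itself; it is parabolic if it is not elliptic and fixes exactly one end of $T$. *)

theory Defs
  imports "Graph_Theory.Graph_Theory" "HOL-Library.Extended_Nat"
begin

text \<open>
  Simple graphs, possibly infinite, are the symmetric loop-free digraphs without parallel arcs
  (\<^locale>\<open>pair_bidirected_digraph\<close>): an edge \<open>{u, v}\<close> is the pair of arcs \<open>(u, v)\<close>, \<open>(v, u)\<close>.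
\<close>

text \<open>
  Every edge \<open>{u, v}\<close> gives a directed cycle \<open>u, v, u\<close> of length 2, so the library's \<^const>\<open>forest\<close>
  and \<^const>\<open>tree\<close> do not apply to symmetric digraphs. The cycles of the undirected graph are the
  directed cycles of length at least 3.
\<close>

definition acyclic_graph :: "'a pair_pre_digraph \<Rightarrow> bool" where
  "acyclic_graph G \<longleftrightarrow> \<not> (\<exists>p. pre_digraph.cycle (with_proj G) p \<and> 3 \<le> length p)"

text \<open>A tree has at least one vertex, since \<^const>\<open>Digraph_Component.connected\<close> excludes the empty graph.\<close>

definition tree_graph :: "'a pair_pre_digraph \<Rightarrow> bool" where
  "tree_graph G \<longleftrightarrow>
     pair_bidirected_digraph G \<and> Digraph_Component.connected (with_proj G) \<and> acyclic_graph G"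

definition locally_finite :: "'a pair_pre_digraph \<Rightarrow> bool" where
  "locally_finite G \<longleftrightarrow> (\<forall>v \<in> pverts G. finite {w. (v, w) \<in> parcs G})"

definition graph_embedding ::
    "'a pair_pre_digraph \<Rightarrow> 'b pair_pre_digraph \<Rightarrow> ('a \<Rightarrow> 'b) \<Rightarrow> bool" where
  "graph_embedding G H f \<longleftrightarrow>
     f ` pverts G \<subseteq> pverts H \<and> inj_on f (pverts G) \<and>
     (\<forall>u v. (u, v) \<in> parcs G \<longrightarrow> (f u, f v) \<in> parcs H)"

definition siblings :: "'a pair_pre_digraph \<Rightarrow> 'b pair_pre_digraph \<Rightarrow> bool" where
  "siblings S T \<longleftrightarrow> (\<exists>f. graph_embedding S T f) \<and> (\<exists>g. graph_embedding T S g)"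

text \<open>
  The vertices of the siblings counted here are taken from the vertex type of \<open>T\<close>. No isomorphism
  class is lost: a tree \<open>S\<close> on any other type that embeds into \<open>T\<close> is isomorphic to its image in \<open>T\<close>.
\<close>

definition sibling_trees :: "'a pair_pre_digraph \<Rightarrow> 'a pair_pre_digraph set" where
  "sibling_trees T = {S. tree_graph S \<and> siblings S T}"

definition sibling_classes :: "'a pair_pre_digraph \<Rightarrow> 'a pair_pre_digraph set set" where
  "sibling_classes T = sibling_trees T //
     {(S, S'). S \<in> sibling_trees T \<and> S' \<in> sibling_trees T \<and>
               digraph_iso (with_proj S) (with_proj S')}"

definition Sib :: "'a pair_pre_digraph \<Rightarrow> enat" where
  "Sib T = (if finite (sibling_classes T) then enat (card (sibling_classes T)) else \<infinity>)"

definition ray :: "'a pair_pre_digraph \<Rightarrow> bool" where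
  "ray R \<longleftrightarrow> (\<exists>x :: nat \<Rightarrow> 'a. inj x \<and> pverts R = range x \<and>
     parcs R = (\<Union>n. {(x n, x (Suc n)), (x (Suc n), x n)}))"

definition rays_of :: "'a pair_pre_digraph \<Rightarrow> 'a pair_pre_digraph set" where
  "rays_of G = {R. ray R \<and> subgraph (with_proj R) (with_proj G)}"

definition graph_inter ::
    "'a pair_pre_digraph \<Rightarrow> 'a pair_pre_digraph \<Rightarrow> 'a pair_pre_digraph" where
  "graph_inter G H = \<lparr>pverts = pverts G \<inter> pverts H, parcs = parcs G \<inter> parcs H\<rparr>"

definition ray_equiv :: "'a pair_pre_digraph \<Rightarrow> 'a pair_pre_digraph rel" where
  "ray_equiv G = {(R, R'). R \<in> rays_of G \<and> R' \<in> rays_of G \<and> ray (graph_inter R R')}"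

definition ends_of :: "'a pair_pre_digraph \<Rightarrow> 'a pair_pre_digraph set set" where
  "ends_of G = rays_of G // ray_equiv G"

definition graph_image :: "('a \<Rightarrow> 'b) \<Rightarrow> 'a pair_pre_digraph \<Rightarrow> 'b pair_pre_digraph" where
  "graph_image f G = \<lparr>pverts = f ` pverts G, parcs = map_prod f f ` parcs G\<rparr>"

definition fixes_end :: "('a \<Rightarrow> 'a) \<Rightarrow> 'a pair_pre_digraph set \<Rightarrow> bool" where
  "fixes_end f \<eta> \<longleftrightarrow> (\<forall>R \<in> \<eta>. graph_image f R \<in> \<eta>)"

definition elliptic_embedding :: "'a pair_pre_digraph \<Rightarrow> ('a \<Rightarrow> 'a) \<Rightarrow> bool" where
  "elliptic_embedding T f \<longleftrightarrow> graph_embedding T T f \<and>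
     (\<exists>S. subgraph (with_proj S) (with_proj T) \<and> tree_graph S \<and> finite (pverts S) \<and>
          graph_image f S = S)"

definition parabolic_embedding :: "'a pair_pre_digraph \<Rightarrow> ('a \<Rightarrow> 'a) \<Rightarrow> bool" where
  "parabolic_embedding T f \<longleftrightarrow> graph_embedding T T f \<and> \<not> elliptic_embedding T f \<and>
     (\<exists>!\<eta>. \<eta> \<in> ends_of T \<and> fixes_end f \<eta>)"

end

theory Submission
  imports Defs "HOL-Library.Countable_Set"
begin

text \<open>
  A parabolic embedding \<open>f\<close> translates a ray \<open>x\<close>, and a maximal such ray has a beginning, since
  otherwise \<open>f\<close> would fix a second end. Maximality makes the iterates of \<open>f\<close> push \<open>T\<close> into the part
  \<open>H n\<close> of \<open>T\<close> behind \<open>x n\<close>, for every \<open>n\<close>. So every subtree that contains some \<open>H n\<close> is a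
  sibling of \<open>T\<close>, and unless \<open>T\<close> is a ray, infinitely many \<open>x n\<close> are branch vertices.

  If a second ray branches infinitely often, cut \<open>T\<close> down to some \<open>H n\<close>, that ray, and pendant edges
  at an arbitrary set of its branch vertices. The set is determined by the isomorphism class together
  with one arc, and there are only countably many arcs, so uncountably many classes arise.

  Otherwise let \<open>W n\<close> consist of \<open>H n\<close> and the bare path from \<open>x 0\<close> to \<open>x n\<close>. An isomorphism between
  \<open>W n\<close> and \<open>W m\<close> preserves the end of \<open>x\<close>, hence shifts a tail of \<open>x\<close>. The shift is not \<open>0\<close>, because
  a locally finite tree does not embed properly into itself with a fixed vertex; so the side trees
  along \<open>x\<close> are eventually periodic and their leaves have bounded depth. Then for all large \<open>n\<close> the
  leaf \<open>x 0\<close> of \<open>W n\<close> is the one farthest from all branch vertices, and it recovers \<open>n\<close>.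
\<close>

section \<open>Distances in trees\<close>

lemma tree_graph_wf: "tree_graph G \<Longrightarrow> pair_bidirected_digraph G"
  by (simp add: tree_graph_def)

lemma tree_parcs_sym: "tree_graph G \<Longrightarrow> (u, v) \<in> parcs G \<Longrightarrow> (v, u) \<in> parcs G"
  by (drule tree_graph_wf)
    (auto simp: pair_bidirected_digraph_def pair_sym_digraph_def pair_sym_digraph_axioms_def
      symmetric_def sym_def)

lemma tree_parcs_verts:
  "tree_graph G \<Longrightarrow> (u, v) \<in> parcs G \<Longrightarrow> u \<in> pverts G \<and> v \<in> pverts G"
  using pair_wf_digraph.in_arcsD1 pair_wf_digraph.in_arcsD2 tree_graph_wf
    pair_bidirected_digraph_def pair_sym_digraph_def by metis

lemma tree_parcs_irrefl: "tree_graph G \<Longrightarrow> (u, u) \<notin> parcs G"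
  by (drule tree_graph_wf) (metis fst_conv snd_conv pair_bidirected_digraph_def
      pair_loopfree_digraph.pair_no_loops)

fun arcs_of :: "'a list \<Rightarrow> ('a \<times> 'a) list" where
  "arcs_of (u # v # vs) = (u, v) # arcs_of (v # vs)"
| "arcs_of _ = []"

lemma length_arcs_of: "length (arcs_of vs) = length vs - 1"
  by (induction vs rule: arcs_of.induct) auto

lemma arcs_of_pawalk:
  "pawalk_verts (hd vs) (arcs_of vs) = vs \<and> pcas (hd vs) (arcs_of vs) (last vs)" if "vs \<noteq> []"
  using that by (induction vs rule: arcs_of.induct) auto

lemma arcs_of_subset: "successively (\<lambda>u v. (u, v) \<in> E) vs \<Longrightarrow> set (arcs_of vs) \<subseteq> E"
  by (induction vs rule: arcs_of.induct) auto

text \<open>Cycles of the library are lists of arcs. Putting the last vertex in front of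
  \<open>vs\<close> closes the path, and the resulting walk has as many arcs as \<open>vs\<close>
  has vertices.\<close>

lemma tree_no_cycle:
  assumes G: "tree_graph G" and vs: "distinct vs" "3 \<le> length vs"
    and "successively (\<lambda>u v. (u, v) \<in> parcs G) vs" "(last vs, hd vs) \<in> parcs G"
  shows False
proof -
  let ?ws = "last vs # vs"
  let ?p = "arcs_of ?ws"
  have ne: "vs \<noteq> []" using vs by auto
  have succ: "successively (\<lambda>u v. (u, v) \<in> parcs G) ?ws"
    using assms ne by (cases vs) auto
  have 1: "pawalk_verts (last vs) ?p = ?ws" "pcas (last vs) ?p (last vs)"
    using arcs_of_pawalk[of ?ws] ne by auto
  have 2: "set ?p \<subseteq> parcs G" using arcs_of_subset[OF succ] .
  have 4: "?p \<noteq> []" using ne by (cases vs) auto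
  have 3: "last vs \<in> pverts G" using tree_parcs_verts[OF G assms(5)] by simp
  have "pre_digraph.cycle (with_proj G) ?p"
    unfolding pre_digraph.cycle_def pre_digraph.awalk_def cas_with_proj_eq awalk_verts_with_proj_eq
    using 1 2 3 4 vs(1) by (intro exI[of _ "last vs"]) simp
  moreover have "3 \<le> length ?p" using vs by (simp add: length_arcs_of)
  ultimately show False using G by (auto simp: tree_graph_def acyclic_graph_def)
qed

text \<open>Connectedness is strong connectedness of the symmetric closure. Here the closure changes
  nothing, so connectedness becomes reachability in \<open>G\<close> itself.\<close>

lemma mk_symmetric_sym: "sym (parcs G) \<Longrightarrow> mk_symmetric (with_proj G) = G"
  by (rule pair_pre_digraph.equality) (force simp: mk_symmetric_def dest: symD)+

lemma mk_symmetric_tree: "tree_graph G \<Longrightarrow> mk_symmetric (with_proj G) = G"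
  by (rule mk_symmetric_sym) (auto intro: symI tree_parcs_sym)

lemma tree_connected:
  assumes G: "tree_graph G" and "u \<in> pverts G" "v \<in> pverts G"
  shows "(u, v) \<in> (parcs G)\<^sup>*"
proof -
  have "reachable (with_proj G) u v"
    using assms mk_symmetric_tree[OF G]
    by (simp add: tree_graph_def Digraph_Component.connected_def strongly_connected_def)
  thus ?thesis by (metis reachable_rtranclI with_proj_simps(3))
qed

lemma tree_nonempty: "tree_graph G \<Longrightarrow> pverts G \<noteq> {}"
  by (auto simp: tree_graph_def Digraph_Component.connected_def strongly_connected_def
    mk_symmetric_def)

text \<open>Walks are powers of the arc relation, so that they can be joined and split by the laws
  of \<open>^^\<close>.\<close>

definition gdist :: "'a pair_pre_digraph \<Rightarrow> 'a \<Rightarrow> 'a \<Rightarrow> nat" where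
  "gdist G u v = (LEAST n. (u, v) \<in> parcs G ^^ n)"

text \<open>Walks of length \<open>n\<close> that do not backtrack. In a tree these are exactly the
  geodesics, and being a local condition it passes to images under embeddings.\<close>

definition nbt :: "'a pair_pre_digraph \<Rightarrow> (nat \<Rightarrow> 'a) \<Rightarrow> nat \<Rightarrow> bool" where
  "nbt G p n \<longleftrightarrow> p 0 \<in> pverts G \<and> (\<forall>i<n. (p i, p (Suc i)) \<in> parcs G) \<and>
     (\<forall>i. Suc (Suc i) \<le> n \<longrightarrow> p i \<noteq> p (Suc (Suc i)))"

locale graph_tree =
  fixes G :: "'a pair_pre_digraph"
  assumes tree: "tree_graph G"
begin

abbreviation V where "V \<equiv> pverts G"
abbreviation adj where "adj u v \<equiv> (u, v) \<in> parcs G"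
abbreviation d where "d \<equiv> gdist G"

lemmas adj_sym = tree_parcs_sym[OF tree]
lemmas adj_irrefl = tree_parcs_irrefl[OF tree]

lemma adj_in_V: "adj u v \<Longrightarrow> u \<in> V" "adj u v \<Longrightarrow> v \<in> V"
  using tree_parcs_verts[OF tree] by auto

lemma d_walk: "u \<in> V \<Longrightarrow> v \<in> V \<Longrightarrow> (u, v) \<in> parcs G ^^ d u v"
  unfolding gdist_def using tree_connected[OF tree] by (metis LeastI_ex rtrancl_power)

lemma d_le: "(u, v) \<in> parcs G ^^ n \<Longrightarrow> d u v \<le> n"
  unfolding gdist_def by (rule Least_le)

lemma walk_sym: "(u, v) \<in> parcs G ^^ n \<Longrightarrow> (v, u) \<in> parcs G ^^ n"
proof (induction n arbitrary: v)
  case (Suc n)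
  then obtain w where "(u, w) \<in> parcs G ^^ n" "adj w v" by auto
  thus ?case using Suc.IH adj_sym relpow_Suc_I2 by metis
qed auto

lemma d_sym: "d u v = d v u"
  unfolding gdist_def using walk_sym by metis

lemma d_refl [simp]: "d u u = 0"
  using d_le[of u u 0] by simp

lemma d_eq_0: "u \<in> V \<Longrightarrow> v \<in> V \<Longrightarrow> d u v = 0 \<longleftrightarrow> u = v"
  using d_walk[of u v] by auto

lemma d_triangle: "u \<in> V \<Longrightarrow> v \<in> V \<Longrightarrow> w \<in> V \<Longrightarrow> d u w \<le> d u v + d v w"
  by (rule d_le) (auto simp: relpow_add intro: relcompI[OF d_walk d_walk])

lemma d_adj: "adj u v \<Longrightarrow> d u v = 1"
  using d_le[of u v 1] d_eq_0[of u v] adj_in_V adj_irrefl by fastforce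

lemma pred_exists:
  assumes "r \<in> V" "v \<in> V" "d r v = Suc n"
  shows "\<exists>w. adj w v \<and> d r w = n"
proof -
  obtain w where w: "(r, w) \<in> parcs G ^^ n" "adj w v"
    using d_walk[OF assms(1,2)] assms(3) by auto
  have "d r w \<le> n" using d_le w by auto
  moreover have "Suc n \<le> d r w + 1"
    using d_triangle[of r w v] d_adj[OF w(2)] assms adj_in_V[OF w(2)] by simp
  ultimately show ?thesis using w by force
qed

text \<open>The path runs through the common ancestors of \<open>u\<close> and \<open>w\<close>.\<close>

lemma level_path:
  assumes "r \<in> V" "u \<in> V" "w \<in> V" "u \<noteq> w" "d r u = n" "d r w = n"
  shows "\<exists>p. distinct p \<and> 3 \<le> length p \<and> successively adj p \<and> hd p = u \<and> last p = w \<and>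
    (\<forall>x \<in> set p. d r x \<le> n)"
  using assms
proof (induction n arbitrary: u w)
  case 0
  thus ?case using d_eq_0[of r u] d_eq_0[of r w] by auto
next
  case (Suc n)
  obtain u' where u': "adj u' u" "d r u' = n" using pred_exists Suc.prems by metis
  obtain w' where w': "adj w' w" "d r w' = n" using pred_exists Suc.prems by metis
  show ?case
  proof (cases "u' = w'")
    case True
    have "distinct [u, u', w]" using Suc.prems u' w' True by auto
    thus ?thesis using Suc.prems u' w' True adj_sym[OF u'(1)]
      by (intro exI[of _ "[u, u', w]"]) auto
  next
    case False
    then obtain p where p: "distinct p" "3 \<le> length p" "successively adj p" "hd p = u'" "last p = w'"
      "\<forall>x \<in> set p. d r x \<le> n"
      using Suc.IH[of u' w'] Suc.prems u' w' adj_in_V by metis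
    have "p \<noteq> []" using p(2) by auto
    hence "successively adj (u # p @ [w])"
      using p w' adj_sym[OF u'(1)] by (auto simp: successively_Cons successively_append_iff)
    moreover have "u \<notin> set p" "w \<notin> set p" using p(6) Suc.prems(5,6) by force+
    moreover have "\<forall>x \<in> set p. d r x \<le> Suc n" using p(6) by auto
    ultimately show ?thesis using p(1,2) Suc.prems(4-6)
      by (intro exI[of _ "u # p @ [w]"]) auto
  qed
qed

text \<open>An edge within a level would close the path of \<open>level_path\<close> to a
  cycle.\<close>

lemma adj_level_neq:
  assumes "r \<in> V" "adj u w"
  shows "d r u \<noteq> d r w"
proof
  assume "d r u = d r w"
  then obtain p where "distinct p" "3 \<le> length p" "successively adj p" "hd p = u" "last p = w"
    using level_path[of r u w "d r u"] assms adj_in_V adj_irrefl by metis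
  thus False using tree_no_cycle[OF tree, of p] adj_sym[OF assms(2)] by auto
qed

text \<open>Two parents of \<open>v\<close> would be joined by a path that stays below the level of
  \<open>v\<close>, and \<open>v\<close> would close it to a cycle.\<close>

lemma pred_unique:
  assumes "r \<in> V" "adj u v" "adj w v" "d r v = Suc (d r u)" "d r w = d r u"
  shows "u = w"
proof (rule ccontr)
  assume "u \<noteq> w"
  then obtain p where p: "distinct p" "3 \<le> length p" "successively adj p" "hd p = u" "last p = w"
      "\<forall>x \<in> set p. d r x \<le> d r u"
    using level_path[of r u w "d r u"] assms adj_in_V by metis
  have "p \<noteq> []" using p(2) by auto
  have "v \<notin> set p" using p(6) assms(4) by force
  thus False using tree_no_cycle[OF tree, of "v # p"] adj_sym[OF assms(2)] assms p \<open>p \<noteq> []\<close>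
    by (auto simp: successively_Cons)
qed

lemma adj_level:
  assumes "r \<in> V" "adj u w"
  shows "d r w = Suc (d r u) \<or> d r u = Suc (d r w)"
proof -
  have "d r w \<le> d r u + 1" "d r u \<le> d r w + 1"
    using d_triangle[of r u w] d_triangle[of r w u] d_adj[OF assms(2)] d_adj[OF adj_sym[OF assms(2)]]
      assms adj_in_V by fastforce+
  thus ?thesis using adj_level_neq[OF assms] by linarith
qed

text \<open>The parent of a vertex is unique, so a walk that does not backtrack and once moves away
  from \<open>r\<close> never comes closer to \<open>r\<close> again.\<close>

lemma level_step:
  assumes "r \<in> V" "adj u v" "adj v w" "u \<noteq> w" "d r v = Suc (d r u)"
  shows "d r w = Suc (d r v)"
  using adj_level[of r v w] pred_unique[of r u v w] assms adj_sym[OF assms(3)] by auto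

lemma nbt_in_V: "nbt G p n \<Longrightarrow> i \<le> n \<Longrightarrow> p i \<in> V"
  using adj_in_V(2)[of "p (i - 1)" "p i"] by (cases i) (auto simp: nbt_def)

lemma nbt_level:
  assumes "nbt G p n" "r \<in> V" "d r (p (Suc i)) = Suc (d r (p i))" "i + j \<le> n" "i < n"
  shows "d r (p (i + j)) = d r (p i) + j"
proof -
  \<comment> \<open>The induction carries the level of the following vertex along, since
    \<open>level_step\<close> needs two consecutive levels.\<close>
  have *: "i + j \<le> n \<longrightarrow> d r (p (i + j)) = d r (p i) + j \<and>
    (i + j < n \<longrightarrow> d r (p (Suc (i + j))) = d r (p i) + Suc j)" for j
  proof (induction j)
    case 0
    show ?case using assms by simp
  next
    case (Suc j)
    show ?case
    proof (intro impI conjI)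
      assume le: "i + Suc j \<le> n"
      thus 1: "d r (p (i + Suc j)) = d r (p i) + Suc j" using Suc by simp
      assume lt: "i + Suc j < n"
      have "adj (p (i + j)) (p (Suc (i + j)))" "adj (p (Suc (i + j))) (p (Suc (Suc (i + j))))"
        "p (i + j) \<noteq> p (Suc (Suc (i + j)))"
        using assms(1) lt by (auto simp: nbt_def)
      moreover have "d r (p (Suc (i + j))) = Suc (d r (p (i + j)))" using Suc lt by simp
      ultimately have "d r (p (Suc (Suc (i + j)))) = Suc (d r (p (Suc (i + j))))"
        by (rule level_step[OF assms(2)])
      thus "d r (p (Suc (i + Suc j))) = d r (p i) + Suc (Suc j)" using 1 by simp
    qed
  qed
  show ?thesis using *[of j] assms(4) by blast
qed

text \<open>Take \<open>p i\<close> itself as the root: the first step leaves it, so all later steps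
  move away as well.\<close>

lemma nbt_dist:
  assumes "nbt G p n" "i + j \<le> n"
  shows "d (p i) (p (i + j)) = j"
proof (cases j)
  case (Suc j')
  have V: "p i \<in> V" using nbt_in_V[OF assms(1), of i] assms(2) by simp
  have adj: "adj (p i) (p (Suc i))" using assms Suc by (auto simp: nbt_def)
  show ?thesis
    using nbt_level[OF assms(1) V _ assms(2)] assms(2) Suc d_adj[OF adj] by simp
qed simp

lemma geodesic_exists:
  assumes "u \<in> V" "v \<in> V"
  obtains p where "nbt G p (d u v)" "p 0 = u" "p (d u v) = v"
proof -
  obtain p where p: "p 0 = u" "p (d u v) = v" "\<forall>i < d u v. adj (p i) (p (Suc i))"
    using d_walk[OF assms] by (auto simp: relpow_fun_conv)
  have inV: "p i \<in> V" if "i \<le> d u v" for i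
    using that assms p adj_in_V(2)[of "p (i - 1)" "p i"] by (cases i) auto
  have le: "d (p i) (p (i + j)) \<le> j" if "i + j \<le> d u v" for i j
  proof -
    have "(p i, p (i + j)) \<in> parcs G ^^ j"
      using p that by (auto simp: relpow_fun_conv intro!: exI[of _ "\<lambda>l. p (i + l)"])
    thus ?thesis using d_le by simp
  qed
  \<comment> \<open>A backtrack could be cut out, which would make the shortest walk shorter by
    two.\<close>
  have "p i \<noteq> p (Suc (Suc i))" if i: "Suc (Suc i) \<le> d u v" for i
  proof
    assume eq: "p i = p (Suc (Suc i))"
    obtain l where l: "d u v = Suc (Suc i) + l" using i le_Suc_ex by blast
    have pl: "p (Suc (Suc i) + l) = v" by (simp only: l[symmetric] p(2))
    have "d u v \<le> d u (p i) + d (p i) v"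
      using d_triangle assms inV i by simp
    also have "d u (p i) \<le> i" using le[of 0 i] p i by simp
    also have "d (p i) v \<le> l" using le[of "Suc (Suc i)" l] eq pl l by simp
    finally show False using l by simp
  qed
  thus ?thesis using that p assms by (auto simp: nbt_def)
qed

end

lemma nbt_embedding:
  assumes "graph_embedding S T f" "tree_graph S" "nbt S p n"
  shows "nbt T (f \<circ> p) n"
proof -
  interpret graph_tree S using assms(2) by unfold_locales
  have "p i \<in> pverts S" if "i \<le> n" for i using nbt_in_V[OF assms(3) that] .
  thus ?thesis using assms unfolding nbt_def graph_embedding_def
    by (auto simp: inj_on_eq_iff dest!: bspec)
qed

text \<open>The image of a geodesic does not backtrack, so it is again a geodesic.\<close>

lemma embedding_isometric:
  assumes "tree_graph S" "tree_graph T" "graph_embedding S T f" "u \<in> pverts S" "v \<in> pverts S"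
  shows "gdist T (f u) (f v) = gdist S u v"
proof -
  interpret S: graph_tree S using assms by unfold_locales
  interpret T: graph_tree T using assms by unfold_locales
  obtain p where "nbt S p (gdist S u v)" "p 0 = u" "p (gdist S u v) = v"
    using S.geodesic_exists assms by metis
  thus ?thesis using T.nbt_dist[of "f \<circ> p" "gdist S u v" 0 "gdist S u v"] nbt_embedding[OF assms(3,1)]
    by simp
qed

section \<open>Subtrees and siblings\<close>

definition induce :: "'a pair_pre_digraph \<Rightarrow> 'a set \<Rightarrow> 'a pair_pre_digraph" where
  "induce G W = \<lparr>pverts = W, parcs = {(u, v) \<in> parcs G. u \<in> W \<and> v \<in> W}\<rparr>"

lemma induce_simps [simp]:
  "pverts (induce G W) = W"
  "(u, v) \<in> parcs (induce G W) \<longleftrightarrow> (u, v) \<in> parcs G \<and> u \<in> W \<and> v \<in> W"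
  by (auto simp: induce_def)

lemma digraph_iso_refl:
  assumes "wf_digraph G"
  shows "digraph_iso G G"
proof -
  let ?f = "\<lparr>iso_verts = \<lambda>v. v, iso_arcs = \<lambda>a. a, iso_head = head G, iso_tail = tail G\<rparr>"
  have "pre_digraph.digraph_isomorphism G ?f"
    using assms by (auto simp: pre_digraph.digraph_isomorphism_def)
  moreover have "G = app_iso ?f G" by (auto simp: app_iso_def intro!: pre_digraph.equality)
  ultimately show ?thesis unfolding digraph_iso_def by blast
qed

section \<open>Pigeonhole principles for families of siblings\<close>

context
  fixes T :: "'a pair_pre_digraph" and S :: "'i \<Rightarrow> 'a pair_pre_digraph" and I :: "'i set"
  assumes fin: "Sib T \<noteq> \<infinity>" and S: "\<And>i. i \<in> I \<Longrightarrow> S i \<in> sibling_trees T"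
begin

private definition cls :: "'i \<Rightarrow> 'a pair_pre_digraph set" where
  "cls i = {(S, S'). S \<in> sibling_trees T \<and> S' \<in> sibling_trees T \<and>
     digraph_iso (with_proj S) (with_proj S')} `` {S i}"

private lemma finite_cls: "finite (cls ` I)"
proof (rule finite_subset)
  show "cls ` I \<subseteq> sibling_classes T"
    unfolding sibling_classes_def cls_def by (intro image_subsetI quotientI S)
  show "finite (sibling_classes T)" using fin by (simp add: Sib_def split: if_splits)
qed

private lemma cls_iso:
  assumes "i \<in> I" "j \<in> I" "cls j = cls i"
  shows "digraph_iso (with_proj (S i)) (with_proj (S j))"
proof -
  have "wf_digraph (with_proj (S j))"
    using S[OF assms(2)] tree_graph_wf[of "S j"]
    by unfold_locales
      (auto simp: sibling_trees_def dest: tree_parcs_verts)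
  hence "S j \<in> cls j"
    using S[OF assms(2)] digraph_iso_refl unfolding cls_def by auto
  thus ?thesis using assms(3) unfolding cls_def by auto
qed

lemma infinitely_many_isomorphic:
  assumes "infinite I"
  shows "\<exists>i \<in> I. infinite {j \<in> I. digraph_iso (with_proj (S i)) (with_proj (S j))}"
proof -
  obtain i where "i \<in> I" "infinite {j \<in> I. cls j = cls i}"
    using pigeonhole_infinite[OF assms finite_cls] by auto
  thus ?thesis using cls_iso
    by (intro bexI[of _ i]) (auto elim!: infinite_super[rotated])
qed

text \<open>Otherwise \<open>I\<close> would be covered by finitely many countable fibres of
  \<open>cls\<close>.\<close>

lemma uncountably_many_isomorphic:
  assumes "uncountable I"
  shows "\<exists>i \<in> I. uncountable {j \<in> I. digraph_iso (with_proj (S i)) (with_proj (S j))}"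
proof (rule ccontr)
  assume "\<not> ?thesis"
  hence c: "countable {j \<in> I. digraph_iso (with_proj (S i)) (with_proj (S j))}" if "i \<in> I" for i
    using that by blast
  have *: "countable {j \<in> I. cls j = cls i}" if "i \<in> I" for i
    by (rule countable_subset[OF _ c[OF that]]) (use cls_iso that in auto)
  have "I = (\<Union>c \<in> cls ` I. {j \<in> I. cls j = c})" by auto
  moreover have "countable (\<Union>c \<in> cls ` I. {j \<in> I. cls j = c})"
    using * finite_cls by (intro countable_UN) (auto intro: countable_finite)
  ultimately show False using assms by simp
qed

end

section \<open>Connected vertex sets, isomorphisms between them, and cones\<close>

context graph_tree
begin

lemma d_add_triangle: "u \<in> V \<Longrightarrow> adj v w \<Longrightarrow> d u w \<le> Suc (d u v)"
  using d_triangle[of u v w] d_adj[of v w] adj_in_V[of v w] by simp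

text \<open>Connectedness is expressed by a step towards \<open>r\<close> inside \<open>W\<close>.
  This is easy to check for unions of cones, paths and pendant edges.\<close>

definition rooted_subtree :: "'a \<Rightarrow> 'a set \<Rightarrow> bool" where
  "rooted_subtree r W \<longleftrightarrow> r \<in> W \<and> W \<subseteq> V \<and>
     (\<forall>v \<in> W. v \<noteq> r \<longrightarrow> (\<exists>w \<in> W. adj w v \<and> d r w < d r v))"

lemma rooted_subtree_connected:
  assumes W: "rooted_subtree r W" and "v \<in> W"
  shows "(r, v) \<in> (parcs (induce G W))\<^sup>*"
  using \<open>v \<in> W\<close>
proof (induction "d r v" arbitrary: v rule: less_induct)
  case less
  show ?case
  proof (cases "v = r")
    case False
    then obtain w where w: "w \<in> W" "adj w v" "d r w < d r v"
      using W less.prems unfolding rooted_subtree_def by blast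
    have "(w, v) \<in> parcs (induce G W)" using w less.prems by simp
    with less.hyps[OF w(3,1)] show ?thesis by (rule rtrancl_into_rtrancl)
  qed simp
qed

lemma tree_graph_induce:
  assumes W: "rooted_subtree r W"
  shows "tree_graph (induce G W)"
proof -
  let ?S = "induce G W"
  have WV: "W \<subseteq> V" and rW: "r \<in> W" using W by (auto simp: rooted_subtree_def)
  have sym: "sym (parcs ?S)" using adj_sym by (auto intro: symI)
  have bi: "pair_bidirected_digraph ?S"
    using adj_irrefl sym by unfold_locales (auto simp: symmetric_def)
  have mk: "mk_symmetric (with_proj ?S) = ?S"
    using sym by (rule mk_symmetric_sym)
  interpret S: pair_bidirected_digraph ?S by fact
  have "reachable (with_proj ?S) u v" if "u \<in> W" "v \<in> W" for u v
  proof -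
    have "(u, r) \<in> (parcs ?S)\<^sup>*"
      using rooted_subtree_connected[OF W that(1)] sym_rtrancl[OF sym] by (auto elim: symE)
    hence "(u, v) \<in> (parcs ?S)\<^sup>*"
      using rooted_subtree_connected[OF W that(2)] by (rule rtrancl_trans)
    thus ?thesis using that S.reachable_conv by simp
  qed
  hence conn: "Digraph_Component.connected (with_proj ?S)"
    unfolding Digraph_Component.connected_def mk using rW by (auto simp: strongly_connected_def)
  have "pre_digraph.cycle (with_proj G) p" if "pre_digraph.cycle (with_proj ?S) p" for p
    using that WV unfolding pre_digraph.cycle_def pre_digraph.awalk_def cas_with_proj_eq
      awalk_verts_with_proj_eq by (auto simp: induce_def)
  hence "acyclic_graph ?S" using tree by (auto simp: tree_graph_def acyclic_graph_def)
  with bi conn show ?thesis by (simp add: tree_graph_def)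
qed

lemma induce_embedding: "W \<subseteq> V \<Longrightarrow> graph_embedding (induce G W) G (\<lambda>v. v)"
  by (auto simp: graph_embedding_def)

lemma induce_sibling:
  assumes "rooted_subtree r W" "graph_embedding G G f" "f ` V \<subseteq> W"
  shows "induce G W \<in> sibling_trees G"
proof -
  have "W \<subseteq> V" using assms by (auto simp: rooted_subtree_def)
  moreover have "graph_embedding G (induce G W) f"
    using assms adj_in_V by (auto simp: graph_embedding_def)
  ultimately show ?thesis
    using tree_graph_induce[OF assms(1)] induce_embedding
    by (auto simp: sibling_trees_def siblings_def)
qed

definition subtree_iso :: "'a set \<Rightarrow> 'a set \<Rightarrow> ('a \<Rightarrow> 'a) \<Rightarrow> bool" where
  "subtree_iso W W' h \<longleftrightarrow> bij_betw h W W' \<and> (\<forall>u \<in> W. \<forall>v \<in> W. adj (h u) (h v) \<longleftrightarrow> adj u v)"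

text \<open>Without parallel arcs the arc map of an isomorphism is determined by its vertex map,
  which therefore preserves adjacency in both directions.\<close>

lemma subtree_isoI:
  assumes "digraph_iso (with_proj (induce G W)) (with_proj (induce G W'))"
  obtains h where "subtree_iso W W' h"
proof -
  let ?S = "with_proj (induce G W)"
  obtain f where f: "pre_digraph.digraph_isomorphism ?S f"
    "with_proj (induce G W') = app_iso f ?S"
    using assms by (auto simp: digraph_iso_def)
  let ?h = "iso_verts f"
  have eqs: "pverts (induce G W') = ?h ` W" "parcs (induce G W') = iso_arcs f ` parcs (induce G W)"
    "iso_tail f = fst" "iso_head f = snd"
    using arg_cong[OF f(2), of verts] arg_cong[OF f(2), of arcs] arg_cong[OF f(2), of tail]
      arg_cong[OF f(2), of head] by auto
  have inj: "inj_on ?h W" and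
    arc: "\<And>a. a \<in> parcs (induce G W) \<Longrightarrow> iso_arcs f a = (?h (fst a), ?h (snd a))"
    using f(1) eqs(3,4) unfolding pre_digraph.digraph_isomorphism_def
    by (auto simp: prod_eq_iff)
  have "adj (?h u) (?h v) \<longleftrightarrow> adj u v" if "u \<in> W" "v \<in> W" for u v
  proof -
    have mem: "?h u \<in> W'" "?h v \<in> W'" using eqs(1) that by auto
    have "adj (?h u) (?h v) \<longleftrightarrow> (?h u, ?h v) \<in> iso_arcs f ` parcs (induce G W)"
      unfolding eqs(2)[symmetric] using mem by simp
    also have "\<dots> \<longleftrightarrow> (u, v) \<in> parcs (induce G W)"
    proof
      assume "(?h u, ?h v) \<in> iso_arcs f ` parcs (induce G W)"
      then obtain a b where ab: "(a, b) \<in> parcs (induce G W)" "(?h u, ?h v) = (?h a, ?h b)"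
        using arc by fastforce
      hence "a \<in> W" "b \<in> W" "?h u = ?h a" "?h v = ?h b" by auto
      thus "(u, v) \<in> parcs (induce G W)" using ab(1) inj that by (metis inj_onD)
    next
      assume "(u, v) \<in> parcs (induce G W)"
      thus "(?h u, ?h v) \<in> iso_arcs f ` parcs (induce G W)"
        using arc[of "(u, v)"] by (intro rev_image_eqI[of "(u, v)"]) auto
    qed
    finally show ?thesis using that by simp
  qed
  hence "subtree_iso W W' ?h" using inj eqs(1) by (auto simp: subtree_iso_def bij_betw_def)
  thus ?thesis by (rule that)
qed

lemma subtree_iso_inv:
  assumes "subtree_iso W W' h"
  shows "subtree_iso W' W (inv_into W h)"
proof -
  have b: "bij_betw h W W'" using assms by (simp add: subtree_iso_def)
  have "adj (inv_into W h u) (inv_into W h v) \<longleftrightarrow> adj u v" if "u \<in> W'" "v \<in> W'" for u v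
  proof -
    have "inv_into W h u \<in> W" "inv_into W h v \<in> W"
      using bij_betw_inv_into[OF b] that by (auto dest: bij_betwE)
    thus ?thesis using assms that bij_betw_inv_into_right[OF b] unfolding subtree_iso_def by metis
  qed
  thus ?thesis using bij_betw_inv_into[OF b] by (simp add: subtree_iso_def)
qed

text \<open>Both \<open>h\<close> and the inclusion of \<open>W\<close> embed the induced tree into
  \<open>G\<close>, and both are isometric.\<close>

lemma subtree_iso_dist:
  assumes W: "rooted_subtree r W" and W': "W' \<subseteq> V" and h: "subtree_iso W W' h"
    and "u \<in> W" "v \<in> W"
  shows "d (h u) (h v) = d u v"
proof -
  have "graph_embedding (induce G W) G h"
    using h W' by (auto simp: graph_embedding_def subtree_iso_def bij_betw_def)
  moreover have "W \<subseteq> V" using W by (simp add: rooted_subtree_def)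
  ultimately show ?thesis
    using embedding_isometric[OF tree_graph_induce[OF W] tree, of h u v]
      embedding_isometric[OF tree_graph_induce[OF W] tree induce_embedding, of u v] assms(4,5)
    by simp
qed

text \<open>The part of the tree behind \<open>v\<close> as seen from \<open>r\<close>: the formula
  says that \<open>v\<close> lies on the path from \<open>r\<close> to \<open>u\<close>.\<close>

definition cone :: "'a \<Rightarrow> 'a \<Rightarrow> 'a set" where
  "cone r v = {u \<in> V. d r u = d r v + d v u}"

lemma cone_self: "v \<in> V \<Longrightarrow> v \<in> cone r v"
  by (simp add: cone_def)

lemma cone_down:
  assumes "r \<in> V" "v \<in> V" "u \<in> cone r v" "adj w u" "d v u = Suc (d v w)"
  shows "w \<in> cone r v"
proof -
  have "w \<in> V" using adj_in_V assms(4) by blast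
  hence "d r u \<le> Suc (d r w)" "d r w \<le> d r v + d v w" "w \<in> V"
    using d_add_triangle[OF assms(1,4)] d_triangle[OF assms(1,2)] by auto
  thus ?thesis using assms by (auto simp: cone_def)
qed

lemma cone_up:
  assumes "r \<in> V" "v \<in> V" "u \<in> cone r v" "adj u w" "d r w = Suc (d r u)"
  shows "w \<in> cone r v"
proof -
  have "w \<in> V" using adj_in_V assms(4) by blast
  hence "d v w \<le> Suc (d v u)" "d r w \<le> d r v + d v w" "w \<in> V"
    using d_add_triangle[OF assms(2,4)] d_triangle[OF assms(1,2)] by auto
  thus ?thesis using assms by (auto simp: cone_def)
qed

text \<open>Children of \<open>u\<close> stay in the cone. By uniqueness of parents, the neighbour
  of \<open>u\<close> towards \<open>r\<close> is also its neighbour towards \<open>v\<close>, and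
  that one is in the cone.\<close>

lemma cone_neighbour:
  assumes "r \<in> V" "v \<in> V" "u \<in> cone r v" "u \<noteq> v" "adj u w"
  shows "w \<in> cone r v"
proof (cases "d r w = Suc (d r u)")
  case True
  thus ?thesis using cone_up assms by blast
next
  case False
  hence rw: "d r u = Suc (d r w)" using adj_level[of r u w] assms by auto
  have uV: "u \<in> V" using adj_in_V assms by blast
  obtain n where n: "d v u = Suc n" using d_eq_0[of v u] assms uV by (cases "d v u") auto
  then obtain w' where w': "adj w' u" "d v w' = n" using pred_exists assms uV by metis
  have c: "w' \<in> cone r v" using cone_down[of r v u w'] assms w' n by simp
  have "d r w' = d r v + d v w'" "d r u = d r v + d v u" using c assms(3) by (auto simp: cone_def)
  hence eq: "d r w = d r w'" using w'(2) n rw by linarith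
  have "w' = w" using pred_unique[OF assms(1) w'(1) adj_sym[OF assms(5)] _ eq] rw eq by linarith
  thus ?thesis using c by simp
qed

lemma cone_rooted_subtree:
  assumes "r \<in> V" "v \<in> V"
  shows "rooted_subtree v (cone r v)"
proof -
  have "\<exists>w \<in> cone r v. adj w u \<and> d v w < d v u" if u: "u \<in> cone r v" "u \<noteq> v" for u
  proof -
    have uV: "u \<in> V" using u by (simp add: cone_def)
    obtain n where n: "d v u = Suc n" using d_eq_0[of v u] assms uV u by (cases "d v u") auto
    then obtain w where w: "adj w u" "d v w = n" using pred_exists assms uV by metis
    thus ?thesis using cone_down[of r v u w] assms u n by auto
  qed
  thus ?thesis using cone_self assms by (auto simp: rooted_subtree_def cone_def)
qed

end

section \<open>Rays and ends\<close>

text \<open>A local condition that embeddings preserve. In a tree it implies injectivity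
  (\<open>ray_inj\<close>), so these sequences parametrize the subgraphs that are rays.\<close>

definition nb_ray :: "'a pair_pre_digraph \<Rightarrow> (nat \<Rightarrow> 'a) \<Rightarrow> bool" where
  "nb_ray G x \<longleftrightarrow> (\<forall>i. (x i, x (Suc i)) \<in> parcs G) \<and> (\<forall>i. x i \<noteq> x (Suc (Suc i)))"

definition ray_graph :: "(nat \<Rightarrow> 'a) \<Rightarrow> 'a pair_pre_digraph" where
  "ray_graph x = \<lparr>pverts = range x, parcs = (\<Union>n. {(x n, x (Suc n)), (x (Suc n), x n)})\<rparr>"

text \<open>The counterpart of \<open>ray_equiv\<close> for parametrized rays
  (\<open>ray_equiv_iff\<close>); in this form transitivity is easy.\<close>

definition tail_equiv :: "(nat \<Rightarrow> 'a) \<Rightarrow> (nat \<Rightarrow> 'a) \<Rightarrow> bool" where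
  "tail_equiv x y \<longleftrightarrow> (\<exists>a b. \<forall>i. x (a + i) = y (b + i))"

lemma ray_iff: "ray R \<longleftrightarrow> (\<exists>x. inj x \<and> R = ray_graph x)"
  by (auto simp: ray_def ray_graph_def intro!: pair_pre_digraph.equality)

lemma tail_equiv_sym: "tail_equiv x y \<Longrightarrow> tail_equiv y x"
  unfolding tail_equiv_def by metis

lemma tail_equiv_trans:
  assumes "tail_equiv x y" "tail_equiv y z"
  shows "tail_equiv x z"
proof -
  obtain a b c e where 1: "\<And>i. x (a + i) = y (b + i)" and 2: "\<And>i. y (c + i) = z (e + i)"
    using assms unfolding tail_equiv_def by blast
  have "x ((a + c) + i) = z ((e + b) + i)" for i
    using 1[of "c + i"] 2[of "b + i"] by (simp add: ac_simps)
  thus ?thesis unfolding tail_equiv_def by blast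
qed

lemma tail_equiv_comp: "tail_equiv x y \<Longrightarrow> tail_equiv (f \<circ> x) (f \<circ> y)"
  unfolding tail_equiv_def comp_def by metis

lemma ray_graph_arcs:
  "(x i, x (Suc i)) \<in> parcs (ray_graph x)" "(x (Suc i), x i) \<in> parcs (ray_graph x)"
  by (auto simp: ray_graph_def)

lemma inj_nb_ray:
  assumes "inj x" "parcs (ray_graph x) \<subseteq> parcs G"
  shows "nb_ray G x"
proof -
  have "x i \<noteq> x (Suc (Suc i))" for i using assms(1) by (simp add: inj_eq)
  thus ?thesis using assms(2) ray_graph_arcs(1)[of x] by (auto simp: nb_ray_def)
qed

lemma graph_image_ray: "graph_image f (ray_graph x) = ray_graph (f \<circ> x)"
  by (auto simp: graph_image_def ray_graph_def image_image image_UN)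

lemma nb_ray_shift: "nb_ray G x \<Longrightarrow> nb_ray G (\<lambda>i. x (n + i))"
  by (simp add: nb_ray_def)

context graph_tree
begin

lemma nb_ray_nbt: "nb_ray G x \<Longrightarrow> nbt G x n"
  using adj_in_V(1)[of "x 0" "x 1"] by (auto simp: nb_ray_def nbt_def)

lemma ray_in_V: "nb_ray G x \<Longrightarrow> x i \<in> V"
  using nbt_in_V[OF nb_ray_nbt[of x i], of i] by simp

lemma ray_dist: "nb_ray G x \<Longrightarrow> d (x i) (x (i + j)) = j"
  using nbt_dist[OF nb_ray_nbt[of x "i + j"], of i j] by simp

lemma ray_dist_0: "nb_ray G x \<Longrightarrow> d (x 0) (x j) = j"
  using ray_dist[of x 0 j] by simp

lemma ray_dist_le: "nb_ray G x \<Longrightarrow> i \<le> j \<Longrightarrow> d (x i) (x j) = j - i"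
  using ray_dist[of x i "j - i"] by simp

lemma ray_inj:
  assumes "nb_ray G x" shows "inj x"
proof (rule injI)
  fix i j assume "x i = x j"
  thus "i = j" using ray_dist_0[OF assms] by metis
qed

lemma ray_level:
  assumes "nb_ray G x" "r \<in> V" "d r (x (Suc i)) = Suc (d r (x i))"
  shows "d r (x (i + j)) = d r (x i) + j"
  by (rule nbt_level[OF nb_ray_nbt[OF assms(1), of "Suc (i + j)"] assms(2,3)]) simp_all

text \<open>The distance to \<open>r\<close> cannot decrease forever, and after one increase it
  keeps increasing.\<close>

lemma ray_eventually_away:
  assumes "nb_ray G x" "r \<in> V"
  obtains b where "\<And>i. d r (x (b + i)) = d r (x b) + i"
proof -
  have "\<exists>b. d r (x (Suc b)) = Suc (d r (x b))"
  proof (rule ccontr)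
    assume "\<not> ?thesis"
    hence *: "d r (x b) = Suc (d r (x (Suc b)))" for b
      using adj_level[OF assms(2), of "x b" "x (Suc b)"] assms(1) by (auto simp: nb_ray_def)
    have "d r (x b) + b = d r (x 0)" for b
    proof (induction b)
      case (Suc b)
      thus ?case using *[of b] by linarith
    qed simp
    from this[of "Suc (d r (x 0))"] show False by simp
  qed
  thus ?thesis using that ray_level[OF assms] by metis
qed

text \<open>Once \<open>z\<close> moves away from \<open>x 0\<close>, the distance to
  \<open>x 0\<close> tells which vertex of \<open>x\<close> is met.\<close>

lemma ray_subset_tail_equiv:
  assumes "nb_ray G z" "nb_ray G x" "range z \<subseteq> range x"
  shows "tail_equiv z x"
proof -
  obtain b where b: "\<And>i. d (x 0) (z (b + i)) = d (x 0) (z b) + i"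
    using ray_eventually_away[OF assms(1) ray_in_V[OF assms(2)]] by metis
  have "z (b + i) = x (d (x 0) (z b) + i)" for i
  proof -
    obtain m where "z (b + i) = x m" using assms(3) by blast
    thus ?thesis using b[of i] ray_dist_0[OF assms(2), of m] by simp
  qed
  thus ?thesis unfolding tail_equiv_def by blast
qed

lemma rays_coincide:
  assumes x: "nb_ray G x" and y: "nb_ray G y" and "x 0 = y 0" "x n = y n" "i \<le> n"
  shows "x i = y i"
  using assms(4,5)
proof (induction n)
  case (Suc n)
  have "x n = y n"
  proof (rule pred_unique[of "x 0" _ "x (Suc n)"])
    show "x 0 \<in> V" using ray_in_V x by blast
    show "adj (x n) (x (Suc n))" using x by (auto simp: nb_ray_def)
    show "adj (y n) (x (Suc n))" using y unfolding Suc.prems(1) by (auto simp: nb_ray_def)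
    show "d (x 0) (x (Suc n)) = Suc (d (x 0) (x n))" "d (x 0) (y n) = d (x 0) (x n)"
      using ray_dist_0[OF x] ray_dist_0[OF y] assms(3) by simp_all
  qed
  thus ?case using Suc by (cases "i = Suc n") auto
qed (use assms in simp)

text \<open>The intersection is the tail of \<open>x\<close> from the least index \<open>a\<close>
  where the rays merge. A common vertex before that would let them merge earlier, because paths in a
  tree are unique.\<close>

lemma tail_equiv_inter:
  assumes x: "nb_ray G x" and y: "nb_ray G y" and "tail_equiv x y"
  shows "ray (graph_inter (ray_graph x) (ray_graph y))"
proof -
  define P where "P a \<longleftrightarrow> (\<exists>b. \<forall>i. x (a + i) = y (b + i))" for a
  define a where "a = (LEAST a. P a)"
  have "\<exists>a. P a" using assms(3) by (auto simp: P_def tail_equiv_def)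
  hence "P a" unfolding a_def by (rule LeastI_ex)
  then obtain b where b: "\<And>i. x (a + i) = y (b + i)" unfolding P_def by blast
  have ge: "a \<le> j" if "x j = y l" for j l
  proof (rule ccontr)
    assume "\<not> a \<le> j"
    hence ja: "j < a" by simp
    \<comment> \<open>Comparing distances from the common vertex to
      \<open>x (a + l) = y (b + l)\<close> shows that both rays need equally many steps to the
      merging point.\<close>
    have "d (x j) (x (a + l)) = a + l - j" using ray_dist_le[OF x] ja by simp
    moreover have "d (y l) (y (b + l)) = b" using ray_dist_le[OF y] by simp
    ultimately have b': "b + j = a + l" using b[of l] that ja by simp
    have "x (j + i) = y (l + i)" for i
    proof (cases "i \<le> a - j")
      case True
      have "j + (a - j) = a" "l + (a - j) = b" using ja b' by auto
      hence "x (j + (a - j)) = y (l + (a - j))" using b[of 0] by simp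
      thus ?thesis
        using rays_coincide[OF nb_ray_shift[OF x, of j] nb_ray_shift[OF y, of l], of "a - j" i] that True
        by simp
    next
      case False
      hence "j + i = a + (i - (a - j))" "l + i = b + (i - (a - j))" using ja b' by auto
      thus ?thesis using b[of "i - (a - j)"] by simp
    qed
    hence "P j" unfolding P_def by blast
    thus False using ja not_less_Least[of j P] by (simp add: a_def)
  qed
  have verts: "range x \<inter> range y = range (\<lambda>i. x (a + i))"
  proof (intro equalityI subsetI)
    fix v assume "v \<in> range x \<inter> range y"
    then obtain j l where "v = x j" "x j = y l" by auto
    thus "v \<in> range (\<lambda>i. x (a + i))" using ge[of j l] by (auto intro: image_eqI[of _ _ "j - a"])
  next
    fix v assume "v \<in> range (\<lambda>i. x (a + i))"
    then obtain i where "v = x (a + i)" by auto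
    moreover have "x (a + i) = y (b + i)" by (rule b)
    ultimately show "v \<in> range x \<inter> range y" by (metis IntI rangeI)
  qed
  have "graph_inter (ray_graph x) (ray_graph y) = ray_graph (\<lambda>i. x (a + i))"
  proof (rule pair_pre_digraph.equality)
    show "pverts (graph_inter (ray_graph x) (ray_graph y)) = pverts (ray_graph (\<lambda>i. x (a + i)))"
      using verts by (simp add: graph_inter_def ray_graph_def)
    show "parcs (graph_inter (ray_graph x) (ray_graph y)) = parcs (ray_graph (\<lambda>i. x (a + i)))"
    proof (intro equalityI subrelI)
      fix u v assume "(u, v) \<in> parcs (graph_inter (ray_graph x) (ray_graph y))"
      then obtain n where n: "(u, v) = (x n, x (Suc n)) \<or> (u, v) = (x (Suc n), x n)"
        and "u \<in> range y" "v \<in> range y"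
        by (auto simp: graph_inter_def ray_graph_def)
      then obtain l l' where "u = y l" "v = y l'" by blast
      hence "x n = y l \<or> x n = y l'" using n by auto
      hence "a \<le> n" using ge by blast
      thus "(u, v) \<in> parcs (ray_graph (\<lambda>i. x (a + i)))"
        using n by (auto simp: ray_graph_def intro!: exI[of _ "n - a"])
    next
      fix u v assume "(u, v) \<in> parcs (ray_graph (\<lambda>i. x (a + i)))"
      then obtain n where n: "(u, v) = (x (a + n), x (Suc (a + n))) \<or> (u, v) = (x (Suc (a + n)), x (a + n))"
        by (auto simp: ray_graph_def)
      have "x (Suc (a + n)) = y (Suc (b + n))" using b[of "Suc n"] by simp
      hence "(u, v) \<in> parcs (ray_graph y)"
        using n b[of n] ray_graph_arcs[of y "b + n"] by auto
      thus "(u, v) \<in> parcs (graph_inter (ray_graph x) (ray_graph y))"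
        using n ray_graph_arcs[of x "a + n"] by (auto simp: graph_inter_def)
    qed
  qed simp
  thus ?thesis using ray_inj[OF nb_ray_shift[OF x, of a]] unfolding ray_iff by blast
qed

lemma ray_graph_in_rays_of:
  assumes "nb_ray G x"
  shows "ray_graph x \<in> rays_of G"
proof -
  have "wf_digraph (with_proj G)"
    using adj_in_V by unfold_locales auto
  moreover have "wf_digraph (with_proj (ray_graph x))"
    by unfold_locales (auto simp: ray_graph_def)
  moreover have "range x \<subseteq> V" "parcs (ray_graph x) \<subseteq> parcs G"
    using ray_in_V[OF assms] assms adj_sym by (auto simp: ray_graph_def nb_ray_def)
  ultimately show ?thesis
    using ray_inj[OF assms] unfolding rays_of_def ray_iff subgraph_def
    by (auto simp: ray_graph_def)
qed

lemma rays_ofE: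
  assumes "R \<in> rays_of G"
  obtains x where "nb_ray G x" "R = ray_graph x"
proof -
  obtain x where x: "inj x" "R = ray_graph x" using assms by (auto simp: rays_of_def ray_iff)
  have "parcs (ray_graph x) \<subseteq> parcs G" using assms x by (auto simp: rays_of_def subgraph_def)
  hence "nb_ray G x" using x(1) inj_nb_ray by blast
  thus ?thesis using x that by blast
qed

text \<open>A ray inside another ray is tail equivalent to it, so the intersection links
  \<open>x\<close> and \<open>y\<close>.\<close>

lemma ray_equiv_iff:
  assumes x: "nb_ray G x" and y: "nb_ray G y"
  shows "(ray_graph x, ray_graph y) \<in> ray_equiv G \<longleftrightarrow> tail_equiv x y"
proof
  assume "(ray_graph x, ray_graph y) \<in> ray_equiv G"
  hence "ray (graph_inter (ray_graph x) (ray_graph y))" by (simp add: ray_equiv_def)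
  then obtain z where z: "inj z" "graph_inter (ray_graph x) (ray_graph y) = ray_graph z"
    by (auto simp: ray_iff)
  have v: "range z = range x \<inter> range y"
    using arg_cong[OF z(2), of pverts] by (auto simp: graph_inter_def ray_graph_def)
  have "parcs (ray_graph z) \<subseteq> parcs (ray_graph x)"
    unfolding z(2)[symmetric] by (auto simp: graph_inter_def)
  also have "\<dots> \<subseteq> parcs G" using x adj_sym by (auto simp: ray_graph_def nb_ray_def)
  finally have "nb_ray G z" using z(1) inj_nb_ray by blast
  hence "tail_equiv z x" "tail_equiv z y" using ray_subset_tail_equiv v x y by auto
  thus "tail_equiv x y" using tail_equiv_sym tail_equiv_trans by blast
next
  assume "tail_equiv x y"
  thus "(ray_graph x, ray_graph y) \<in> ray_equiv G"
    using tail_equiv_inter[OF x y] ray_graph_in_rays_of x y by (simp add: ray_equiv_def)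
qed

definition end_of :: "(nat \<Rightarrow> 'a) \<Rightarrow> 'a pair_pre_digraph set" where
  "end_of x = ray_equiv G `` {ray_graph x}"

lemma end_of_in_ends: "nb_ray G x \<Longrightarrow> end_of x \<in> ends_of G"
  unfolding end_of_def ends_of_def using ray_graph_in_rays_of by (rule quotientI)

lemma end_of_neq:
  assumes "nb_ray G x" "nb_ray G y" "\<not> tail_equiv x y"
  shows "end_of x \<noteq> end_of y"
proof
  assume "end_of x = end_of y"
  moreover have "tail_equiv y y" by (auto simp: tail_equiv_def)
  ultimately have "(ray_graph x, ray_graph y) \<in> ray_equiv G"
    using ray_equiv_iff[OF assms(2,2)] by (auto simp: end_of_def)
  thus False using ray_equiv_iff assms by blast
qed

lemma nb_ray_embedding:
  assumes "graph_embedding G G f" "nb_ray G x"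
  shows "nb_ray G (f \<circ> x)"
  using assms ray_in_V[OF assms(2)] by (auto simp: nb_ray_def graph_embedding_def inj_on_eq_iff)

lemma end_of_fixed:
  assumes f: "graph_embedding G G f" and x: "nb_ray G x" and "tail_equiv x (f \<circ> x)"
  shows "fixes_end f (end_of x)"
  unfolding fixes_end_def
proof
  fix R assume R: "R \<in> end_of x"
  then obtain y where y: "nb_ray G y" "R = ray_graph y"
    using rays_ofE by (auto simp: end_of_def ray_equiv_def)
  have "tail_equiv x y" using R ray_equiv_iff[OF x y(1)] y(2) by (auto simp: end_of_def)
  hence "tail_equiv x (f \<circ> y)" using assms(3) tail_equiv_trans tail_equiv_comp by blast
  hence "(ray_graph x, ray_graph (f \<circ> y)) \<in> ray_equiv G"
    using ray_equiv_iff[OF x nb_ray_embedding[OF f y(1)]] by simp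
  thus "graph_image f R \<in> end_of x" using y(2) by (simp add: graph_image_ray end_of_def)
qed

text \<open>Seen from a vertex \<open>w (Suc a)\<close>, the walk from \<open>w 1\<close> over
  \<open>x 0\<close> to \<open>x 1\<close> moves away, and hence so does all of \<open>x\<close>,
  which therefore cannot reach that vertex.\<close>

lemma opposite_rays_not_tail_equiv:
  assumes x: "nb_ray G x" and w: "nb_ray G w" and "w 0 = x 0" "w 1 \<noteq> x 1"
  shows "\<not> tail_equiv w x"
proof
  assume "tail_equiv w x"
  then obtain a b where ab: "\<And>i. w (a + i) = x (b + i)" by (auto simp: tail_equiv_def)
  let ?r = "w (Suc a)"
  have r: "?r \<in> V" using ray_in_V w by blast
  have d: "d ?r (w 0) = Suc a" "d ?r (w 1) = a"
    using ray_dist_le[OF w, of 0 "Suc a"] ray_dist_le[OF w, of 1 "Suc a"] d_sym by auto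
  have "adj (w 0) (w 1)" "adj (x 0) (x 1)" using x w by (auto simp: nb_ray_def)
  hence "adj (w 1) (x 0)" "adj (x 0) (x 1)" using adj_sym assms(3) by auto
  hence "d ?r (x 1) = Suc (d ?r (x 0))"
    using level_step[OF r] assms(3,4) d by auto
  from ray_level[OF x r, of 0 "Suc b"] this have "d ?r (x (Suc b)) > 0" by simp
  thus False using ab[of 1] by simp
qed

end

section \<open>The axis of a parabolic embedding\<close>

lemma graph_embedding_funpow: "graph_embedding G G f \<Longrightarrow> graph_embedding G G (f ^^ n)"
proof (induction n)
  case (Suc n)
  hence IH: "graph_embedding G G (f ^^ n)" by simp
  have "inj_on (f \<circ> f ^^ n) (pverts G)"
    using IH Suc.prems by (intro comp_inj_on) (auto simp: graph_embedding_def intro: inj_on_subset)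
  thus ?case using IH Suc.prems by (auto simp: graph_embedding_def comp_def)
qed (auto simp: graph_embedding_def)

context graph_tree
begin

lemma elliptic_induce:
  assumes f: "graph_embedding G G f" and W: "rooted_subtree r W" "finite W" "f ` W = W"
    and "\<And>u v. u \<in> W \<Longrightarrow> v \<in> W \<Longrightarrow> adj u v \<Longrightarrow>
      (u, v) \<in> map_prod f f ` parcs (induce G W)"
  shows "elliptic_embedding G f"
proof -
  have WV: "W \<subseteq> V" using W by (simp add: rooted_subtree_def)
  have "wf_digraph (with_proj G)" using adj_in_V by unfold_locales auto
  moreover have "wf_digraph (with_proj (induce G W))" by unfold_locales auto
  ultimately have sub: "subgraph (with_proj (induce G W)) (with_proj G)"
    using WV by (auto simp: subgraph_def)
  have "parcs (graph_image f (induce G W)) = parcs (induce G W)"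
  proof (intro equalityI subrelI)
    fix u v assume "(u, v) \<in> parcs (graph_image f (induce G W))"
    thus "(u, v) \<in> parcs (induce G W)"
      using f W(3) by (auto simp: graph_image_def graph_embedding_def)
  next
    fix u v assume "(u, v) \<in> parcs (induce G W)"
    thus "(u, v) \<in> parcs (graph_image f (induce G W))" using assms(5) by (auto simp: graph_image_def)
  qed
  hence "graph_image f (induce G W) = induce G W"
    using W(3) by (intro pair_pre_digraph.equality) (auto simp: graph_image_def)
  thus ?thesis using f sub tree_graph_induce[OF W(1)] W(2)
    by (auto simp: elliptic_embedding_def intro!: exI[of _ "induce G W"])
qed

text \<open>Choose \<open>v\<close> with least displacement. A fixed vertex or an inverted edge
  would make \<open>f\<close> elliptic. Otherwise the path from \<open>v\<close> to
  \<open>f v\<close> and its images under the iterates of \<open>f\<close> join to a walk without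
  backtracking.\<close>

lemma translation_axis:
  assumes f: "graph_embedding G G f" and ell: "\<not> elliptic_embedding G f"
  obtains x k where "nb_ray G x" "0 < k" "\<And>i. f (x i) = x (i + k)"
proof -
  have fV: "f v \<in> V" if "v \<in> V" for v using f that by (auto simp: graph_embedding_def)
  have fadj: "adj (f u) (f v)" if "adj u v" for u v using f that by (auto simp: graph_embedding_def)
  obtain v0 where "v0 \<in> V" using tree_nonempty[OF tree] by auto
  hence "\<exists>v. v \<in> V \<and> (\<forall>u. u \<in> V \<longrightarrow> d v (f v) \<le> d u (f u))"
    by (rule ex_has_least_nat)
  then obtain v where v: "v \<in> V" "\<And>u. u \<in> V \<Longrightarrow> d v (f v) \<le> d u (f u)" by blast
  define k where "k = d v (f v)"
  have k: "0 < k"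
  proof (rule ccontr)
    assume "\<not> 0 < k"
    hence "f v = v" using d_eq_0[of v "f v"] v fV by (auto simp: k_def)
    hence "elliptic_embedding G f"
      using v adj_irrefl by (intro elliptic_induce[OF f, of v "{v}"]) (auto simp: rooted_subtree_def)
    thus False using ell by simp
  qed
  obtain p where p: "nbt G p k" "p 0 = v" "p k = f v"
    using geodesic_exists v fV unfolding k_def by metis
  have pV: "p i \<in> V" if "i \<le> k" for i using nbt_in_V[OF p(1) that] .
  have adj01: "adj (p 0) (p 1)" using p(1) k by (auto simp: nbt_def)
  \<comment> \<open>If the walk turned back at \<open>f v\<close>, then \<open>f\<close> would
    invert an edge (\<open>k = 1\<close>) or displace \<open>p 1\<close> by only
    \<open>k - 2\<close>, against the choice of \<open>v\<close>.\<close>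
  have turn: "p (k - 1) \<noteq> f (p 1)"
  proof
    assume eq: "p (k - 1) = f (p 1)"
    show False
    proof (cases "k = 1")
      case True
      have sw: "f (p 0) = p 1" "f (p 1) = p 0" using p True eq by auto
      have dd: "d (p 0) (p 1) = 1" using d_adj[OF adj01] .
      have "elliptic_embedding G f"
      proof (rule elliptic_induce[OF f, of "p 0" "{p 0, p 1}"])
        show "rooted_subtree (p 0) {p 0, p 1}"
          using pV[of 0] pV[of 1] True adj01 dd by (auto simp: rooted_subtree_def)
        show "f ` {p 0, p 1} = {p 0, p 1}" using sw by auto
        fix u v assume "u \<in> {p 0, p 1}" "v \<in> {p 0, p 1}" "adj u v"
        hence "(u, v) = (p 0, p 1) \<or> (u, v) = (p 1, p 0)" using adj_irrefl by auto
        thus "(u, v) \<in> map_prod f f ` parcs (induce G {p 0, p 1})"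
          using sw adj01 adj_sym[OF adj01]
          by (auto intro: image_eqI[of _ _ "(p 0, p 1)"] image_eqI[of _ _ "(p 1, p 0)"])
      qed auto
      thus False using ell by simp
    next
      case False
      hence k1: "1 + (k - 2) = k - 1" using k by simp
      have "d (p 1) (f (p 1)) = k - 2"
        using nbt_dist[OF p(1), of 1 "k - 2"] unfolding k1 eq by simp
      thus False using v(2)[OF pV[of 1]] k False by (simp add: k_def)
    qed
  qed
  define x where "x i = (f ^^ (i div k)) (p (i mod k))" for i
  have emb: "graph_embedding G G (f ^^ n)" for n using graph_embedding_funpow[OF f] .
  \<comment> \<open>The case \<open>r = k\<close> is included, where two blocks meet; there
    \<open>p k = f (p 0)\<close> is used.\<close>
  have x: "x (q * k + r) = (f ^^ q) (p r)" if "r \<le> k" for q r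
  proof (cases "r = k")
    case True
    hence "x (q * k + r) = x (Suc q * k + 0)" by (simp add: add.commute)
    also have "\<dots> = (f ^^ Suc q) (p 0)" unfolding x_def using k by simp
    finally show ?thesis using p True by (simp add: funpow_swap1)
  next
    case False
    thus ?thesis using that by (simp add: x_def)
  qed
  have ray: "nb_ray G x"
    unfolding nb_ray_def
  proof (intro conjI allI)
    fix i
    define q r where "q = i div k" and "r = i mod k"
    have i: "i = q * k + r" and r: "r < k" using k by (auto simp: q_def r_def)
    have x0: "x i = (f ^^ q) (p r)" using x[of r q] i r by simp
    have x1: "x (Suc i) = (f ^^ q) (p (Suc r))" using x[of "Suc r" q] i r by simp
    have "adj (p r) (p (Suc r))" using p(1) r by (auto simp: nbt_def)
    thus "adj (x i) (x (Suc i))" using emb[of q] unfolding x0 x1 by (auto simp: graph_embedding_def)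
    \<comment> \<open>Two steps after \<open>p r\<close> comes \<open>p (r + 2)\<close> or, across
      the end of a block, \<open>f (p 1)\<close>. In both cases \<open>f ^^ q\<close> can be
      cancelled by injectivity.\<close>
    obtain w where w: "w \<in> V" "w \<noteq> p r" "x (Suc (Suc i)) = (f ^^ q) w"
    proof (cases "Suc r = k")
      case True
      have "Suc (Suc i) = Suc q * k + 1" unfolding mult_Suc using i True by linarith
      hence "x (Suc (Suc i)) = (f ^^ Suc q) (p 1)" using x[of 1 "Suc q"] k by simp
      hence "x (Suc (Suc i)) = (f ^^ q) (f (p 1))" by (simp add: funpow_swap1)
      moreover have "f (p 1) \<noteq> p r" using turn True by auto
      moreover have "f (p 1) \<in> V" using fV pV[of 1] k by simp
      ultimately show ?thesis using that by blast
    next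
      case False
      hence "Suc (Suc r) \<le> k" using r by simp
      hence "x (Suc (Suc i)) = (f ^^ q) (p (Suc (Suc r)))" "p r \<noteq> p (Suc (Suc r))" "p (Suc (Suc r)) \<in> V"
        using x[of "Suc (Suc r)" q] i p(1) pV by (auto simp: nbt_def)
      thus ?thesis using that by metis
    qed
    show "x i \<noteq> x (Suc (Suc i))"
      using emb[of q] w pV[of r] r unfolding x0 by (auto simp: graph_embedding_def inj_on_eq_iff)
  qed
  have "f (x i) = x (i + k)" for i using k by (simp add: x_def)
  thus ?thesis using that ray k by blast
qed

text \<open>The last property says that the translated ray cannot be prolonged backwards. If this
  were always possible, the prolongations would form a ray \<open>w\<close> from \<open>x0 0\<close>
  that \<open>f\<close> shifts towards its start, and the end of \<open>w\<close> would be a second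
  fixed end.\<close>

lemma parabolic_axis:
  assumes "parabolic_embedding G f"
  obtains x k where "nb_ray G x" "0 < k" "\<And>i. f (x i) = x (i + k)"
    "\<And>y. adj y (x 0) \<Longrightarrow> f y \<noteq> x (k - 1)"
proof -
  have f: "graph_embedding G G f" and ell: "\<not> elliptic_embedding G f"
    and uniq: "\<And>\<eta> \<eta>'. \<lbrakk>\<eta> \<in> ends_of G; fixes_end f \<eta>; \<eta>' \<in> ends_of G; fixes_end f \<eta>'\<rbrakk> \<Longrightarrow> \<eta> = \<eta>'"
    using assms by (auto simp: parabolic_embedding_def)
  obtain x0 k where x0: "nb_ray G x0" "0 < k" "\<And>i. f (x0 i) = x0 (i + k)"
    using translation_axis[OF f ell] by metis
  define P where "P x \<longleftrightarrow> nb_ray G x \<and> (\<forall>i. f (x i) = x (i + k))" for x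
  have "\<exists>x. P x \<and> (\<forall>y. adj y (x 0) \<longrightarrow> f y \<noteq> x (k - 1))"
  proof (rule ccontr)
    assume "\<not> ?thesis"
    hence "\<forall>x. \<exists>y. P x \<longrightarrow> adj y (x 0) \<and> f y = x (k - 1)" by blast
    then obtain g where g: "\<And>x. P x \<Longrightarrow> adj (g x) (x 0)" "\<And>x. P x \<Longrightarrow> f (g x) = x (k - 1)"
      by metis
    \<comment> \<open>\<open>X n\<close> is \<open>x0\<close> with \<open>n\<close> vertices put in
      front, one at a time, by the choice function \<open>g\<close>.\<close>
    define X where "X = rec_nat x0 (\<lambda>_ x. case_nat (g x) x)"
    have X0: "X 0 = x0" and XS0: "X (Suc n) 0 = g (X n)" and XS: "X (Suc n) (Suc i) = X n i" for n i
      by (auto simp: X_def)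
    have PX: "P (X n)" for n
    proof (induction n)
      case 0
      show ?case using x0 by (simp add: P_def X0)
    next
      case (Suc n)
      have r: "nb_ray G (X n)" and s: "\<And>i. f (X n i) = X n (i + k)" using Suc by (auto simp: P_def)
      \<comment> \<open>These two vertices are the images under \<open>f\<close> of
        \<open>g (X n)\<close> and \<open>X n 1\<close>, so the new vertex causes no
        backtracking.\<close>
      have "X n (k - 1) \<noteq> X n (Suc k)" using r x0(2) unfolding nb_ray_def by (metis Suc_diff_1)
      hence "g (X n) \<noteq> X n 1" using g(2)[OF Suc] s[of 1] by auto
      hence "X (Suc n) i \<noteq> X (Suc n) (Suc (Suc i))" "adj (X (Suc n) i) (X (Suc n) (Suc i))" for i
        using r g(1)[OF Suc] by (cases i; auto simp: XS0 XS nb_ray_def)+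
      moreover have "f (X (Suc n) i) = X (Suc n) (i + k)" for i
        using g(2)[OF Suc] s x0(2) by (cases i; cases k; auto simp: XS0 XS)
      ultimately show ?case by (auto simp: P_def nb_ray_def)
    qed
    have Xm: "X (m + n) (m + i) = X n i" for m n i
      by (induction m) (auto simp: XS)
    define w where "w i = X i 0" for i
    have w: "nb_ray G w"
      unfolding nb_ray_def
    proof (intro conjI allI)
      fix i
      have r: "nb_ray G (X (Suc i))" "nb_ray G (X (Suc (Suc i)))" using PX by (auto simp: P_def)
      have "adj (X (Suc i) 0) (X (Suc i) (Suc 0))" using r by (simp add: nb_ray_def)
      thus "adj (w i) (w (Suc i))" by (auto simp: w_def XS intro: adj_sym)
      have "X (Suc (Suc i)) 0 \<noteq> X (Suc (Suc i)) (Suc (Suc 0))" using r by (simp add: nb_ray_def)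
      thus "w i \<noteq> w (Suc (Suc i))" by (auto simp: w_def XS)
    qed
    have "f (w (k + i)) = w i" for i
      using PX[of "k + i"] Xm[of k i 0] by (simp add: P_def w_def)
    hence "tail_equiv w (f \<circ> w)" unfolding tail_equiv_def
      by (intro exI[of _ 0] exI[of _ k]) simp
    moreover have "tail_equiv x0 (f \<circ> x0)" unfolding tail_equiv_def
      using x0(3) by (intro exI[of _ k] exI[of _ 0]) (simp add: add.commute)
    ultimately have "end_of w = end_of x0"
      using uniq end_of_in_ends end_of_fixed[OF f] w x0(1) by blast
    moreover have "nb_ray G (X 1)" using PX by (auto simp: P_def)
    hence "X 1 0 \<noteq> X 1 2" by (simp add: nb_ray_def numeral_2_eq_2)
    hence "w 1 \<noteq> x0 1" using XS[of 0 1] by (simp add: w_def X0 numeral_2_eq_2)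
    hence "\<not> tail_equiv w x0"
      using opposite_rays_not_tail_equiv[OF x0(1) w] by (auto simp: w_def X0)
    ultimately show False using end_of_neq w x0(1) by blast
  qed
  thus ?thesis using that x0(2) unfolding P_def by blast
qed

end

section \<open>Trees pushed into themselves along a ray\<close>

context graph_tree
begin

text \<open>Degree at least three. This and \<open>leaf_in\<close> (degree at most one) are relative
  to \<open>W\<close>, since cutting the tree down can lower degrees.\<close>

definition branch_in :: "'a set \<Rightarrow> 'a \<Rightarrow> bool" where
  "branch_in W v \<longleftrightarrow> (\<exists>a \<in> W. \<exists>b \<in> W. \<exists>c \<in> W. a \<noteq> b \<and> a \<noteq> c \<and> b \<noteq> c \<and>
     adj v a \<and> adj v b \<and> adj v c)"

definition leaf_in :: "'a set \<Rightarrow> 'a \<Rightarrow> bool" where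
  "leaf_in W v \<longleftrightarrow> (\<forall>a \<in> W. \<forall>b \<in> W. adj v a \<longrightarrow> adj v b \<longrightarrow> a = b)"

lemma branch_inI:
  "\<lbrakk>a \<in> W; b \<in> W; c \<in> W; a \<noteq> b; a \<noteq> c; b \<noteq> c; adj v a; adj v b; adj v c\<rbrakk> \<Longrightarrow> branch_in W v"
  unfolding branch_in_def by blast

lemma branch_in_mono: "branch_in W v \<Longrightarrow> W \<subseteq> W' \<Longrightarrow> branch_in W' v"
  unfolding branch_in_def by blast

lemma branch_in_avoid:
  assumes "branch_in W v"
  obtains z where "z \<in> W" "adj v z" "z \<noteq> a" "z \<noteq> b"
  using assms unfolding branch_in_def by metis

lemma branch_in_iso:
  assumes "subtree_iso W W' h" "v \<in> W" "branch_in W v"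
  shows "branch_in W' (h v)"
proof -
  obtain a b c where *: "a \<in> W" "b \<in> W" "c \<in> W" "a \<noteq> b" "a \<noteq> c" "b \<noteq> c"
    "adj v a" "adj v b" "adj v c"
    using assms(3) unfolding branch_in_def by blast
  have h: "inj_on h W" "h ` W = W'" "\<And>u. u \<in> W \<Longrightarrow> adj v u \<Longrightarrow> adj (h v) (h u)"
    using assms by (auto simp: subtree_iso_def bij_betw_def)
  show ?thesis
    by (rule branch_inI[of "h a" _ "h b" "h c"]) (use * h in \<open>auto simp: inj_on_eq_iff\<close>)
qed

lemma leaf_in_iso:
  assumes "subtree_iso W W' h" "v \<in> W" "leaf_in W' (h v)"
  shows "leaf_in W v"
  unfolding leaf_in_def
proof (intro ballI impI)
  fix a b assume ab: "a \<in> W" "b \<in> W" "adj v a" "adj v b"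
  hence "h a = h b"
    using assms unfolding leaf_in_def subtree_iso_def by (auto dest!: bij_betwE)
  thus "a = b" using ab assms(1) by (auto simp: subtree_iso_def bij_betw_def inj_on_eq_iff)
qed

text \<open>The vertex \<open>c\<close> is the first step on the path from \<open>v\<close> to
  \<open>u\<close>.\<close>

lemma cone_child:
  assumes r: "r \<in> V" and v: "v \<in> V" and u: "u \<in> cone r v" "u \<noteq> v"
  obtains c where "adj v c" "d r c = Suc (d r v)" "u \<in> cone r c" "d v u = Suc (d c u)"
proof -
  have uV: "u \<in> V" and ru: "d r u = d r v + d v u" using u by (auto simp: cone_def)
  obtain n where n: "d u v = Suc n" using d_eq_0[of u v] v uV u(2) by (cases "d u v") auto
  then obtain c where c: "adj c v" "d u c = n" using pred_exists[OF uV v] by metis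
  have cV: "c \<in> V" using adj_in_V c by blast
  have cu: "d v u = Suc (d c u)" using n c(2) d_sym[of u v] d_sym[of u c] by simp
  have le: "d r u \<le> d r c + d c u" using d_triangle[OF r cV uV] .
  have "d r c = Suc (d r v)"
    using adj_level[OF r c(1)] le ru cu by linarith
  moreover from this have "u \<in> cone r c" using uV ru cu by (simp add: cone_def)
  ultimately show ?thesis using that[of c] adj_sym[OF c(1)] cu by blast
qed

lemma finite_sphere:
  assumes "locally_finite G" "r \<in> V"
  shows "finite {v \<in> V. d r v = n}"
proof (induction n)
  case 0
  have "{v \<in> V. d r v = 0} \<subseteq> {r}" using d_eq_0 assms(2) by auto
  thus ?case by (rule finite_subset) simp
next
  case (Suc n)
  have "{v \<in> V. d r v = Suc n} \<subseteq> (\<Union>w \<in> {v \<in> V. d r v = n}. {v. adj w v})"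
  proof
    fix v assume "v \<in> {v \<in> V. d r v = Suc n}"
    then obtain w where "adj w v" "d r w = n" using pred_exists[OF assms(2), of v n] by auto
    thus "v \<in> (\<Union>w \<in> {v \<in> V. d r v = n}. {v. adj w v})" using adj_in_V by auto
  qed
  moreover have "finite (\<Union>w \<in> {v \<in> V. d r v = n}. {v. adj w v})"
    using Suc assms(1) by (auto simp: locally_finite_def)
  ultimately show ?case by (rule finite_subset)
qed

lemma countable_V:
  assumes "locally_finite G"
  shows "countable V"
proof -
  obtain r where "r \<in> V" using tree_nonempty[OF tree] by auto
  hence "countable (\<Union>n. {v \<in> V. d r v = n})"
    using finite_sphere[OF assms] by (intro countable_UN) (auto intro: countable_finite)
  moreover have "V = (\<Union>n. {v \<in> V. d r v = n})" by auto
  ultimately show ?thesis by simp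
qed

text \<open>A path from \<open>x 0\<close> to \<open>v\<close> is mapped to one that starts at
  \<open>x k\<close> and, by \<open>turn\<close>, does not step back to \<open>x (k - 1)\<close>. So
  it moves away from \<open>x 0\<close> from its first step on.\<close>

lemma axis_push:
  assumes f: "graph_embedding G G f" and x: "nb_ray G x" and k: "0 < k"
    and fx: "\<And>i. f (x i) = x (i + k)" and turn: "\<And>y. adj y (x 0) \<Longrightarrow> f y \<noteq> x (k - 1)"
    and v: "v \<in> V"
  shows "d (x 0) (f v) = k + d (x 0) v"
proof (cases "d (x 0) v")
  case 0
  hence "v = x 0" using d_eq_0 ray_in_V[OF x] v by blast
  thus ?thesis using fx[of 0] ray_dist_0[OF x] by simp
next
  case (Suc m)
  let ?r = "x 0"
  have r: "?r \<in> V" using ray_in_V[OF x] .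
  obtain p where p: "nbt G p (Suc m)" "p 0 = ?r" "p (Suc m) = v"
    using geodesic_exists[OF r v] Suc by metis
  have fp: "nbt G (f \<circ> p) (Suc m)" using nbt_embedding[OF f tree p(1)] .
  have fp0: "(f \<circ> p) 0 = x k" using p(2) fx[of 0] by simp
  have pre: "adj (x (k - 1)) (x k)" "d ?r (x k) = Suc (d ?r (x (k - 1)))"
    using x k ray_dist_0[OF x] unfolding nb_ray_def by (metis Suc_diff_1)+
  have "adj ?r (p 1)" using p(1,2) by (auto simp: nbt_def)
  hence "x (k - 1) \<noteq> (f \<circ> p) 1" using turn[of "p 1"] adj_sym[of ?r "p 1"] by auto
  moreover have "adj (x k) ((f \<circ> p) 1)" using fp fp0 by (auto simp: nbt_def)
  ultimately have "d ?r ((f \<circ> p) 1) = Suc (d ?r (x k))"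
    using level_step[OF r pre(1) _ _ pre(2)] by blast
  hence "d ?r ((f \<circ> p) (0 + Suc m)) = d ?r ((f \<circ> p) 0) + Suc m"
    using fp0 by (intro nbt_level[OF fp r]) auto
  thus ?thesis using fp0 p(3) Suc ray_dist_0[OF x] by simp
qed

text \<open>The iterate sends \<open>x 0\<close> to \<open>x (j * k)\<close> and preserves
  distances, while \<open>axis_push\<close> adds \<open>j * k\<close> to the distance from
  \<open>x 0\<close>. Together this is the equation that defines the cone.\<close>

lemma axis_push_funpow:
  assumes f: "graph_embedding G G f" and x: "nb_ray G x" and k: "0 < k"
    and fx: "\<And>i. f (x i) = x (i + k)" and turn: "\<And>y. adj y (x 0) \<Longrightarrow> f y \<noteq> x (k - 1)"
    and v: "v \<in> V"
  shows "(f ^^ j) v \<in> cone (x 0) (x (j * k))"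
proof -
  have emb: "graph_embedding G G (f ^^ i)" for i using graph_embedding_funpow[OF f] .
  have inV: "(f ^^ i) v \<in> V" for i using emb[of i] v by (auto simp: graph_embedding_def)
  have 1: "d (x 0) ((f ^^ i) v) = i * k + d (x 0) v" for i
  proof (induction i)
    case (Suc i)
    thus ?case using axis_push[OF f x k fx turn inV[of i]] by simp
  qed simp
  have "(f ^^ i) (x 0) = x (i * k)" for i
    by (induction i) (auto simp: fx add.commute)
  hence "d (x (j * k)) ((f ^^ j) v) = d (x 0) v"
    using embedding_isometric[OF tree tree emb[of j] ray_in_V[OF x, of 0] v] by simp
  thus ?thesis using 1[of j] inV ray_dist_0[OF x] by (simp add: cone_def)
qed

lemma cone_ray_mono:
  assumes x: "nb_ray G x" and "n \<le> m"
  shows "cone (x 0) (x m) \<subseteq> cone (x 0) (x n)"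
proof
  fix u assume u: "u \<in> cone (x 0) (x m)"
  have V: "x i \<in> V" for i using ray_in_V[OF x] .
  have uV: "u \<in> V" using u by (simp add: cone_def)
  have "d (x 0) u = m + d (x m) u" using u ray_dist_0[OF x] by (simp add: cone_def)
  moreover have "d (x n) u \<le> (m - n) + d (x m) u"
    using d_triangle[OF V V uV, of n m] ray_dist_le[OF x assms(2)] by simp
  moreover have "d (x 0) u \<le> n + d (x n) u"
    using d_triangle[OF V V uV, of 0 n] ray_dist_0[OF x] by simp
  ultimately show "u \<in> cone (x 0) (x n)"
    using uV ray_dist_0[OF x] assms(2) by (simp add: cone_def)
qed

lemma ray_or_side_branch:
  assumes x: "nb_ray G x" and nray: "\<not> ray G"
  obtains i z where "adj (x i) z" "z \<notin> range x"
proof -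
  have "\<exists>i z. adj (x i) z \<and> z \<notin> range x"
  proof (rule ccontr)
    assume no: "\<not> ?thesis"
    have r: "x 0 \<in> V" using ray_in_V[OF x] .
    have "\<forall>v \<in> V. d (x 0) v = n \<longrightarrow> v \<in> range x" for n
    proof (induction n)
      case 0
      thus ?case using d_eq_0[OF r] by auto
    next
      case (Suc n)
      show ?case
      proof (intro ballI impI)
        fix v assume "v \<in> V" "d (x 0) v = Suc n"
        then obtain w where w: "adj w v" "d (x 0) w = n" using pred_exists[OF r] by metis
        then obtain i where "w = x i" using Suc adj_in_V[OF w(1)] by blast
        thus "v \<in> range x" using no w by blast
      qed
    qed
    hence V: "V = range x" using ray_in_V[OF x] by auto
    have "parcs G = parcs (ray_graph x)"
    proof (intro equalityI subrelI)
      fix u v assume uv: "adj u v"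
      then obtain i j where ij: "u = x i" "v = x j" using V adj_in_V[OF uv] by blast
      have "j = Suc i \<or> i = Suc j"
        using adj_level[OF r uv] ray_dist_0[OF x] ij by simp
      thus "(u, v) \<in> parcs (ray_graph x)" using ij ray_graph_arcs[of x] by auto
    next
      fix u v assume "(u, v) \<in> parcs (ray_graph x)"
      thus "adj u v" using x adj_sym by (auto simp: ray_graph_def nb_ray_def)
    qed
    hence "G = ray_graph x" using V by (intro pair_pre_digraph.equality) (auto simp: ray_graph_def)
    thus False using nray ray_inj[OF x] by (auto simp: ray_iff)
  qed
  thus ?thesis using that by blast
qed

text \<open>A side edge at \<open>x i\<close> gives a branch vertex if \<open>i > 0\<close>. At
  \<open>x 0\<close> it need not, but then its image is a side edge at \<open>x k\<close> by
  \<open>turn\<close>. The iterates of \<open>f\<close> carry a branch vertex along the ray.\<close>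

lemma axis_branches:
  assumes f: "graph_embedding G G f" and x: "nb_ray G x" and k: "0 < k"
    and fx: "\<And>i. f (x i) = x (i + k)" and turn: "\<And>y. adj y (x 0) \<Longrightarrow> f y \<noteq> x (k - 1)"
    and nray: "\<not> ray G"
  shows "infinite {n. branch_in V (x n)}"
proof -
  have fadj: "adj (f u) (f v)" if "adj u v" for u v using f that by (auto simp: graph_embedding_def)
  have inj: "f u = f v \<longleftrightarrow> u = v" if "u \<in> V" "v \<in> V" for u v
    using f that by (auto simp: graph_embedding_def inj_on_eq_iff)
  have prev: "adj (x (Suc i)) (x i)" and nxt: "adj (x i) (x (Suc i))" for i
    using x adj_sym by (auto simp: nb_ray_def)
  have neq: "x i \<noteq> x (Suc (Suc i))" for i using x by (simp add: nb_ray_def)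
  obtain i z where z: "adj (x i) z" "z \<notin> range x" using ray_or_side_branch[OF x nray] .
  have "\<exists>n. branch_in V (x n)"
  proof (cases i)
    case (Suc j)
    have "branch_in V (x (Suc j))"
      by (rule branch_inI[of "x j" _ "x (Suc (Suc j))" z])
        (use z Suc prev nxt neq ray_in_V[OF x] adj_in_V[OF z(1)] in auto)
    thus ?thesis by blast
  next
    case 0
    obtain l where l: "k = Suc l" using k by (cases k) auto
    have fz: "adj (x k) (f z)" using fadj[OF z(1)] fx[of 0] 0 by simp
    have "f z \<noteq> x l" using turn[of z] adj_sym[OF z(1)] 0 l by simp
    moreover have "f z \<noteq> x (Suc (Suc l))"
      using fx[of 1] inj[of z "x 1"] z(2) adj_in_V[OF z(1)] ray_in_V[OF x] l by auto
    ultimately have "branch_in V (x (Suc l))"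
      using fz l
      by (intro branch_inI[of "x l" _ "x (Suc (Suc l))" "f z"])
        (use prev nxt neq ray_in_V[OF x] adj_in_V[OF fz] in auto)
    thus ?thesis by blast
  qed
  then obtain n where n: "branch_in V (x n)" by blast
  have br: "branch_in V (x (n + j * k))" for j
  proof (induction j)
    case (Suc j)
    then obtain a b c where "a \<in> V" "b \<in> V" "c \<in> V" "a \<noteq> b" "a \<noteq> c" "b \<noteq> c"
      "adj (x (n + j * k)) a" "adj (x (n + j * k)) b" "adj (x (n + j * k)) c"
      unfolding branch_in_def by blast
    hence "branch_in V (f (x (n + j * k)))"
      using inj fadj adj_in_V(2) by (intro branch_inI[of "f a" _ "f b" "f c"]) blast+
    thus ?case by (simp add: fx algebra_simps)
  qed (use n in simp)
  have "inj (\<lambda>j. n + j * k)" using k by (auto intro: injI)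
  hence "infinite (range (\<lambda>j. n + j * k))" by (rule range_inj_infinite)
  thus ?thesis using br by (elim infinite_super[rotated]) auto
qed

end

text \<open>What the counting of siblings takes over from the parabolic embedding. By
  \<open>push\<close>, every subtree that contains a cone of the ray is a sibling.\<close>

locale pushed_tree = graph_tree +
  fixes x :: "nat \<Rightarrow> 'a"
  assumes lf: "locally_finite G"
    and x: "nb_ray G x"
    and infinite_branches: "infinite {n. branch_in V (x n)}"
    and push: "\<exists>f. graph_embedding G G f \<and> f ` V \<subseteq> cone (x 0) (x n)"
begin

abbreviation H where "H n \<equiv> cone (x 0) (x n)"

lemma xV: "x i \<in> V"
  using ray_in_V[OF x] .

lemma x_adj: "adj (x i) (x (Suc i))" "adj (x (Suc i)) (x i)"
  using x adj_sym by (auto simp: nb_ray_def)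

lemma x_eq: "x i = x j \<longleftrightarrow> i = j"
  using ray_inj[OF x] by (simp add: inj_eq)

lemma d0: "d (x 0) (x n) = n"
  using ray_dist_0[OF x] .

lemma H_V: "H n \<subseteq> V"
  by (auto simp: cone_def)

lemma H_mono: "n \<le> m \<Longrightarrow> H m \<subseteq> H n"
  using cone_ray_mono[OF x] .

lemma in_H: "u \<in> H n \<longleftrightarrow> u \<in> V \<and> d (x 0) u = n + d (x n) u"
  by (simp add: cone_def d0)

lemma x_in_H: "x i \<in> H n \<longleftrightarrow> n \<le> i"
proof
  assume "x i \<in> H n"
  thus "n \<le> i" using d0 by (simp add: in_H)
next
  assume "n \<le> i"
  thus "x i \<in> H n" using xV d0 ray_dist_le[OF x] by (simp add: in_H)
qed

text \<open>The criterion compares distances to the ends of one edge and does not mention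
  \<open>x 0\<close>, so it survives isomorphisms that shift the ray. For the converse, the ray is
  walked backwards: having once moved away from \<open>u\<close>, it does so all the way to
  \<open>x 0\<close>.\<close>

lemma in_H_Suc:
  assumes u: "u \<in> V"
  shows "u \<in> H (Suc n) \<longleftrightarrow> d u (x n) = Suc (d u (x (Suc n)))"
proof
  assume "u \<in> H (Suc n)"
  hence "d (x 0) u = Suc n + d (x (Suc n)) u" by (simp add: in_H)
  moreover have "d (x 0) u \<le> n + d (x n) u" using d_triangle[OF xV xV u, of 0 n] d0 by simp
  ultimately have "Suc (d u (x (Suc n))) \<le> d u (x n)" using d_sym[of u] by simp
  thus "d u (x n) = Suc (d u (x (Suc n)))" using adj_level[OF u x_adj(1), of n] by linarith
next
  assume *: "d u (x n) = Suc (d u (x (Suc n)))"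
  have "i \<le> n \<longrightarrow> d u (x (n - i)) = Suc (d u (x (Suc (n - i)))) \<and>
    d u (x (n - i)) = Suc i + d u (x (Suc n))" for i
  proof (induction i)
    case 0
    thus ?case using * by simp
  next
    case (Suc i)
    show ?case
    proof
      assume le: "Suc i \<le> n"
      define j where "j = n - Suc i"
      have j: "n - i = Suc j" "Suc (n - Suc i) = Suc j" using le by (auto simp: j_def)
      have IH: "d u (x (Suc j)) = Suc (d u (x (Suc (Suc j))))"
        "d u (x (Suc j)) = Suc i + d u (x (Suc n))" using Suc le j by auto
      have "d u (x j) = Suc (d u (x (Suc j)))"
        using level_step[OF u x_adj(2) x_adj(2) _ IH(1)] x_eq by auto
      thus "d u (x (n - Suc i)) = Suc (d u (x (Suc (n - Suc i)))) \<and>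
          d u (x (n - Suc i)) = Suc (Suc i) + d u (x (Suc n))"
        using IH(2) unfolding j(2) j_def[symmetric] by simp
    qed
  qed
  from this[of n] have "d u (x 0) = Suc n + d u (x (Suc n))" by simp
  thus "u \<in> H (Suc n)" using u d_sym[of u] by (simp add: in_H)
qed

lemma sibling_if_cone_subset:
  assumes "rooted_subtree r W" "H n \<subseteq> W"
  shows "induce G W \<in> sibling_trees G"
  using push[of n] induce_sibling[OF assms(1)] assms(2) by blast

end

lemma parabolic_pushed_tree:
  assumes "tree_graph T" "locally_finite T" "parabolic_embedding T f" "\<not> ray T"
  obtains x where "pushed_tree T x"
proof -
  interpret graph_tree T using assms(1) by unfold_locales
  obtain x k where x: "nb_ray T x" and k: "0 < k" and fx: "\<And>i. f (x i) = x (i + k)"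
    and turn: "\<And>y. adj y (x 0) \<Longrightarrow> f y \<noteq> x (k - 1)"
    using parabolic_axis[OF assms(3)] by metis
  have f: "graph_embedding T T f" using assms(3) by (simp add: parabolic_embedding_def)
  have "\<exists>f. graph_embedding T T f \<and> f ` V \<subseteq> cone (x 0) (x n)" for n
  proof (intro exI conjI)
    show "graph_embedding T T (f ^^ n)" using graph_embedding_funpow[OF f] .
    have "cone (x 0) (x (n * k)) \<subseteq> cone (x 0) (x n)" using k by (intro cone_ray_mono[OF x]) simp
    thus "(f ^^ n) ` V \<subseteq> cone (x 0) (x n)"
      using axis_push_funpow[OF f x k fx turn] by blast
  qed
  hence "pushed_tree T x"
    using assms(2) x axis_branches[OF f x k fx turn assms(4)] by unfold_locales auto
  thus ?thesis by (rule that)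
qed

section \<open>A second ray with infinitely many branch vertices\<close>

text \<open>An enumeration of \<open>Pow J\<close>, indexed through a numbering of \<open>J\<close>,
  would map \<open>J\<close> onto its power set.\<close>

lemma uncountable_Pow:
  assumes "infinite J"
  shows "uncountable (Pow J)"
proof
  assume c: "countable (Pow J)"
  have "(\<lambda>a. {a}) ` J \<subseteq> Pow J" by auto
  hence "countable ((\<lambda>a. {a}) ` J)" using c countable_subset by blast
  hence "countable J" by (rule countable_image_inj_on) simp
  hence "(\<lambda>a. from_nat_into (Pow J) (to_nat_on J a)) ` J = Pow J"
    using image_to_nat_on[OF _ assms] range_from_nat_into[OF Pow_not_empty c]
    by (simp flip: image_image)
  thus False using Cantors_theorem[of J] by blast
qed

context pushed_tree
begin

text \<open>The set \<open>A\<close> of pendant edges can be read off the distances in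
  \<open>W A\<close> to both ends of the edge where \<open>y\<close> leaves \<open>x\<close>. An
  isomorphism from a fixed \<open>W A0\<close> thus determines \<open>A\<close> through the
  preimages of these two vertices.\<close>

lemma second_branching_ray:
  assumes y: "nb_ray G y" and y0: "y 0 = x 0" and neq: "y \<noteq> x"
    and inf: "infinite {j. branch_in V (y j)}"
  shows "Sib G = \<infinity>"
proof -
  define n where "n = (LEAST j. y j \<noteq> x j)"
  have "\<exists>j. y j \<noteq> x j" using neq by auto
  hence n: "y n \<noteq> x n" "\<And>j. j < n \<Longrightarrow> y j = x j"
    unfolding n_def by (rule LeastI_ex) (use not_less_Least in blast)
  have "n \<noteq> 0" using n(1) y0 by metis
  then obtain i where i: "n = Suc i" by (cases n) auto
  have yi: "y i = x i" "y (Suc i) \<noteq> x (Suc i)" using n i by auto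
  let ?a = "x (Suc i)" and ?b = "x i"
  have yadj: "adj (y j) (y (Suc j))" "adj (y (Suc j)) (y j)" "y j \<noteq> y (Suc (Suc j))" for j
    using y adj_sym by (auto simp: nb_ray_def)
  \<comment> \<open>This ray enters \<open>y\<close> from \<open>x (Suc i)\<close> and yields the
    distances to both ends of the edge, \<open>da\<close> and \<open>db\<close>.\<close>
  define w where "w = case_nat ?a (\<lambda>t. y (i + t))"
  have w0: "w 0 = ?a" and wS: "w (Suc t) = y (i + t)" for t by (auto simp: w_def)
  have w: "nb_ray G w"
    unfolding nb_ray_def
  proof (intro conjI allI)
    fix t
    show "adj (w t) (w (Suc t))" using x_adj(2)[of i] yi(1) yadj by (cases t) (auto simp: w0 wS)
    show "w t \<noteq> w (Suc (Suc t))" using yi(2) yadj(3) by (cases t) (auto simp: w0 wS)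
  qed
  have da: "d ?a (y (i + t)) = Suc t" for t using ray_dist_0[OF w, of "Suc t"] by (simp add: w0 wS)
  have db: "d ?b (y (i + t)) = t" for t
    using ray_dist[OF w, of "Suc 0" t] yi(1) by (simp add: wS[of 0] wS[of t])
  have yV: "y j \<in> V" for j using ray_in_V[OF y] .
  \<comment> \<open>Indices count from \<open>x i\<close>. It is left out itself, since there
    \<open>x (Suc i)\<close> could be the third neighbour.\<close>
  define J where "J = {t. 0 < t \<and> branch_in V (y (i + t))}"
  have infJ: "infinite J"
  proof
    assume "finite J"
    hence "finite ({..i} \<union> (\<lambda>t. i + t) ` J)" by simp
    moreover have "{j. branch_in V (y j)} \<subseteq> {..i} \<union> (\<lambda>t. i + t) ` J"
    proof
      fix j assume j: "j \<in> {j. branch_in V (y j)}"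
      show "j \<in> {..i} \<union> (\<lambda>t. i + t) ` J"
      proof (cases "j \<le> i")
        case False
        hence "j - i \<in> J" "j = i + (j - i)" using j by (auto simp: J_def)
        thus ?thesis by blast
      qed simp
    qed
    ultimately show False using inf finite_subset by blast
  qed
  have "\<forall>t. \<exists>z. t \<in> J \<longrightarrow> adj (y (i + t)) z \<and> z \<noteq> y (i + t - 1) \<and> z \<noteq> y (Suc (i + t))"
  proof
    fix t
    show "\<exists>z. t \<in> J \<longrightarrow> adj (y (i + t)) z \<and> z \<noteq> y (i + t - 1) \<and> z \<noteq> y (Suc (i + t))"
      using branch_in_avoid[of V "y (i + t)" "y (i + t - 1)" "y (Suc (i + t))"]
      unfolding J_def by blast
  qed
  then obtain z where z: "\<And>t. t \<in> J \<Longrightarrow> adj (y (i + t)) (z t)"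
    "\<And>t. t \<in> J \<Longrightarrow> z t \<noteq> y (i + t - 1)" "\<And>t. t \<in> J \<Longrightarrow> z t \<noteq> y (Suc (i + t))"
    by metis
  have dz: "d ?a (z t) = Suc (Suc t)" "d ?b (z t) = Suc t" if "t \<in> J" for t
  proof -
    obtain s where s: "t = Suc s" using \<open>t \<in> J\<close> by (cases t) (auto simp: J_def)
    have ne: "y (i + s) \<noteq> z t" using z(2)[OF that] s by simp
    have ad: "adj (y (i + s)) (y (i + t))" using yadj s by simp
    have "d ?a (z t) = Suc (d ?a (y (i + t)))"
      by (rule level_step[OF xV ad z(1)[OF that] ne]) (simp add: da s del: add_Suc_right)
    thus "d ?a (z t) = Suc (Suc t)" by (simp add: da)
    have "d ?b (z t) = Suc (d ?b (y (i + t)))"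
      by (rule level_step[OF xV ad z(1)[OF that] ne]) (simp add: db s del: add_Suc_right)
    thus "d ?b (z t) = Suc t" by (simp add: db)
  qed
  define W where "W A = H (Suc i) \<union> range (\<lambda>t. y (i + t)) \<union> z ` A" for A
  have tree_W: "rooted_subtree ?a (W A)" if A: "A \<subseteq> J" for A
    unfolding rooted_subtree_def
  proof (intro conjI ballI impI)
    show "?a \<in> W A" using x_in_H by (simp add: W_def)
    have "z t \<in> V" if "t \<in> A" for t using adj_in_V(2)[OF z(1)[of t]] that A by blast
    thus "W A \<subseteq> V" using H_V yV by (auto simp: W_def)
    fix v assume "v \<in> W A" "v \<noteq> ?a"
    then consider "v \<in> H (Suc i)" | t where "v = y (i + t)" | t where "v = z t" "t \<in> A"
      unfolding W_def by blast
    thus "\<exists>u \<in> W A. adj u v \<and> d ?a u < d ?a v"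
    proof cases
      case 1
      thus ?thesis using cone_rooted_subtree[OF xV[of 0] xV[of "Suc i"]] \<open>v \<noteq> ?a\<close>
        unfolding rooted_subtree_def W_def by blast
    next
      case 2
      show ?thesis
      proof (cases t)
        case 0
        have "?a \<in> W A" using x_in_H by (simp add: W_def)
        moreover have "adj ?a v" using 2 0 yi(1) x_adj by simp
        moreover have "d ?a v = 1" using 2 0 da[of 0] by simp
        ultimately show ?thesis by (intro bexI[of _ ?a]) auto
      next
        case (Suc s)
        have "y (i + s) \<in> W A" by (auto simp: W_def)
        moreover have "adj (y (i + s)) v" using 2 Suc yadj by simp
        moreover have "d ?a (y (i + s)) < d ?a v" unfolding 2 da using Suc by simp
        ultimately show ?thesis by blast
      qed
    next
      case 3
      have t: "t \<in> J" using 3 A by blast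
      have "y (i + t) \<in> W A" by (auto simp: W_def)
      moreover have "adj (y (i + t)) v" using 3 z(1)[OF t] by simp
      moreover have "d ?a (y (i + t)) < d ?a v" unfolding 3 da dz[OF t] by simp
      ultimately show ?thesis by blast
    qed
  qed
  have W_V: "W A \<subseteq> V" and ab: "?a \<in> W A" "?b \<in> W A" if "A \<subseteq> J" for A
    using tree_W[OF that] yi(1) unfolding rooted_subtree_def W_def
    by (auto intro!: image_eqI[of _ _ 0])
  \<comment> \<open>On the side of \<open>x i\<close>, the vertices of \<open>W A\<close> at
    distance \<open>t + 1\<close> from \<open>x i\<close> are \<open>y (i + t + 1)\<close> and, only
    if \<open>t \<in> A\<close>, also \<open>z t\<close>. The distance to \<open>x (Suc i)\<close>
    rules out the cone.\<close>
  have mem_iff: "t \<in> A \<longleftrightarrow> (\<exists>u \<in> W A. \<exists>v \<in> W A. u \<noteq> v \<and>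
      d ?b u = Suc t \<and> d ?a u = Suc (Suc t) \<and> d ?b v = Suc t \<and> d ?a v = Suc (Suc t))"
    if A: "A \<subseteq> J" and t: "t \<in> J" for A t
  proof
    assume tA: "t \<in> A"
    have "y (i + Suc t) \<in> W A" "z t \<in> W A" using tA by (auto simp: W_def simp del: add_Suc_right)
    moreover have "z t \<noteq> y (i + Suc t)" using z(3)[OF t] by simp
    moreover have "d ?b (y (i + Suc t)) = Suc t" "d ?a (y (i + Suc t)) = Suc (Suc t)"
      using db da by blast+
    ultimately show "\<exists>u \<in> W A. \<exists>v \<in> W A. u \<noteq> v \<and>
      d ?b u = Suc t \<and> d ?a u = Suc (Suc t) \<and> d ?b v = Suc t \<and> d ?a v = Suc (Suc t)"
      using dz[OF t] by blast
  next
    assume "\<exists>u \<in> W A. \<exists>v \<in> W A. u \<noteq> v \<and>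
      d ?b u = Suc t \<and> d ?a u = Suc (Suc t) \<and> d ?b v = Suc t \<and> d ?a v = Suc (Suc t)"
    then obtain u v where uv: "u \<in> W A" "v \<in> W A" "u \<noteq> v"
      "d ?b u = Suc t" "d ?a u = Suc (Suc t)" "d ?b v = Suc t" "d ?a v = Suc (Suc t)" by blast
    have "q = y (i + Suc t) \<or> t \<in> A" if q: "q \<in> W A" "d ?b q = Suc t" "d ?a q = Suc (Suc t)" for q
    proof -
      have "q \<notin> H (Suc i)"
        using in_H_Suc[of q i] q H_V d_sym[of q] by auto
      then consider s where "q = y (i + s)" | s where "q = z s" "s \<in> A"
        using q(1) unfolding W_def by blast
      thus ?thesis
      proof cases
        case 1
        hence "s = Suc t" using q(2) db by simp
        thus ?thesis using 1 by simp
      next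
        case 2
        hence "s = t" using q(2) dz(2)[of s] A by auto
        thus ?thesis using 2 by simp
      qed
    qed
    thus "t \<in> A" using uv by metis
  qed
  show ?thesis
  proof (rule ccontr)
    assume fin: "Sib G \<noteq> \<infinity>"
    have "uncountable (Pow J)" using infJ by (rule uncountable_Pow)
    moreover have "induce G (W A) \<in> sibling_trees G" if "A \<in> Pow J" for A
      using sibling_if_cone_subset[OF tree_W, of A "Suc i"] that by (auto simp: W_def)
    ultimately obtain A0 where A0: "A0 \<in> Pow J" and unc: "uncountable {A \<in> Pow J.
        digraph_iso (with_proj (induce G (W A0))) (with_proj (induce G (W A)))}"
      using uncountably_many_isomorphic[OF fin, of "Pow J" "\<lambda>A. induce G (W A)"] by blast
    \<comment> \<open>Here \<open>a\<close> and \<open>b\<close> stand for the preimages in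
      \<open>W A0\<close> of \<open>x (Suc i)\<close> and \<open>x i\<close>.\<close>
    define g where "g = (\<lambda>(a, b). {t \<in> J. \<exists>u \<in> W A0. \<exists>v \<in> W A0. u \<noteq> v \<and>
      d b u = Suc t \<and> d a u = Suc (Suc t) \<and> d b v = Suc t \<and> d a v = Suc (Suc t)})"
    have "{A \<in> Pow J. digraph_iso (with_proj (induce G (W A0))) (with_proj (induce G (W A)))}
      \<subseteq> g ` (V \<times> V)"
    proof
      fix A assume "A \<in> {A \<in> Pow J.
        digraph_iso (with_proj (induce G (W A0))) (with_proj (induce G (W A)))}"
      hence A: "A \<subseteq> J"
        and iso: "digraph_iso (with_proj (induce G (W A0))) (with_proj (induce G (W A)))" by auto
      obtain h where h: "subtree_iso (W A0) (W A) h" using subtree_isoI[OF iso] .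
      have inj: "inj_on h (W A0)" and im: "h ` W A0 = W A"
        using h by (auto simp: subtree_iso_def bij_betw_def)
      have dh: "d (h u) (h v) = d u v" if "u \<in> W A0" "v \<in> W A0" for u v
        using subtree_iso_dist[OF tree_W W_V[OF A] h that] A0 by blast
      obtain a b where a: "a \<in> W A0" "h a = ?a" and b: "b \<in> W A0" "h b = ?b"
        using ab[OF A] im by (metis imageE)
      have "t \<in> A \<longleftrightarrow> t \<in> g (a, b)" if t: "t \<in> J" for t
        unfolding mem_iff[OF A t] g_def im[symmetric]
        using t dh a b inj by (auto simp: inj_on_eq_iff simp flip: a(2) b(2))
      hence "A = g (a, b)" using A by (auto simp: g_def)
      moreover have "(a, b) \<in> V \<times> V" using a b W_V A0 by blast
      ultimately show "A \<in> g ` (V \<times> V)" by blast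
    qed
    moreover have "countable (g ` (V \<times> V))" using countable_V[OF lf] by auto
    ultimately show False using unc countable_subset by blast
  qed
qed

end

section \<open>A unique ray with infinitely many branch vertices\<close>

context graph_tree
begin

lemma ray_from_levels:
  assumes r: "r \<in> V" and "\<And>i. adj (y i) (y (Suc i))" "\<And>i. d r (y i) = i"
  shows "nb_ray G y"
  unfolding nb_ray_def
proof (intro conjI allI)
  fix i
  show "adj (y i) (y (Suc i))" by fact
  have "d r (y i) = i" "d r (y (Suc (Suc i))) = Suc (Suc i)" using assms(3) by blast+
  thus "y i \<noteq> y (Suc (Suc i))" by auto
qed

text \<open>Follow the path from \<open>r\<close> to a vertex \<open>y b\<close> after which
  \<open>y\<close> only moves away from \<open>r\<close>, then continue along
  \<open>y\<close>.\<close>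

lemma ray_reroot:
  assumes y: "nb_ray G y" and r: "r \<in> V"
  obtains y' where "nb_ray G y'" "y' 0 = r" "tail_equiv y y'"
proof -
  obtain b where b: "\<And>i. d r (y (b + i)) = d r (y b) + i" using ray_eventually_away[OF y r] by blast
  define m where "m = d r (y b)"
  obtain p where p: "nbt G p m" "p 0 = r" "p m = y b"
    using geodesic_exists[OF r ray_in_V[OF y, of b]] unfolding m_def by metis
  define y' where "y' i = (if i \<le> m then p i else y (b + (i - m)))" for i
  have y'm: "y' (m + i) = y (b + i)" for i using p(3) by (auto simp: y'_def)
  have "d r (y' i) = i" for i
  proof (cases "i \<le> m")
    case True
    thus ?thesis using nbt_dist[OF p(1), of 0 i] p(2) by (simp add: y'_def)
  next
    case False
    thus ?thesis using b[of "i - m"] by (simp add: y'_def m_def)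
  qed
  moreover have "adj (y' i) (y' (Suc i))" for i
  proof (cases "i < m")
    case True
    thus ?thesis using p(1) by (simp add: y'_def nbt_def)
  next
    case False
    then obtain l where l: "i = m + l" using le_Suc_ex not_less by metis
    have "adj (y (b + l)) (y (Suc (b + l)))" using y by (simp add: nb_ray_def)
    thus ?thesis using y'm[of l] y'm[of "Suc l"] l by simp
  qed
  ultimately have "nb_ray G y'" by (intro ray_from_levels[OF r])
  moreover have "y' 0 = r" using p(2) by (simp add: y'_def)
  moreover have "tail_equiv y y'" unfolding tail_equiv_def
    by (intro exI[of _ b] exI[of _ m]) (simp add: y'm)
  ultimately show ?thesis by (rule that)
qed

text \<open>Balls in \<open>W\<close> around the fixed vertex are finite and mapped into themselves.\<close>

lemma self_embedding_fixing_vertex: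
  assumes lf: "locally_finite G" and W: "rooted_subtree r W" and h: "subtree_iso W W' h"
    and "W' \<subseteq> W" "w \<in> W" "h w = w"
  shows "W' = W"
proof -
  have WV: "W \<subseteq> V" using W by (simp add: rooted_subtree_def)
  have inj: "inj_on h W" and im: "h ` W = W'" using h by (auto simp: subtree_iso_def bij_betw_def)
  have "u \<in> W'" if u: "u \<in> W" for u
  proof -
    let ?S = "{v \<in> W. d w v = d w u}"
    have "?S \<subseteq> {v \<in> V. d w v = d w u}" using WV by auto
    moreover have "finite {v \<in> V. d w v = d w u}" using finite_sphere[OF lf] WV assms(5) by blast
    ultimately have fin: "finite ?S" by (rule finite_subset)
    have "d w (h v) = d w v" if "v \<in> W" for v
      using subtree_iso_dist[OF W _ h assms(5) that] assms(4,6) WV by auto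
    hence "h ` ?S \<subseteq> ?S" using im assms(4) by auto
    moreover have "inj_on h ?S" using inj by (rule inj_on_subset) auto
    ultimately have "h ` ?S = ?S" using fin endo_inj_surj by blast
    moreover have "u \<in> ?S" using u by simp
    ultimately show ?thesis using im by blast
  qed
  thus ?thesis using assms(4) by blast
qed

end

locale single_branching_ray = pushed_tree +
  assumes single: "\<lbrakk>nb_ray G y; y 0 = x 0; infinite {j. branch_in V (y j)}\<rbrakk> \<Longrightarrow> y = x"
begin

definition W :: "nat \<Rightarrow> 'a set" where
  "W n = H n \<union> x ` {..<n}"

text \<open>Cutting at branch vertices makes the sets \<open>W n\<close> strictly decreasing, and
  \<open>0 < n\<close> makes \<open>x 0\<close> a leaf of \<open>W n\<close>.\<close>

definition N :: "nat set" where
  "N = {n. 0 < n \<and> branch_in V (x n)}"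

lemma infinite_N: "infinite N"
proof
  assume "finite N"
  hence "finite (insert 0 N)" by simp
  moreover have "{n. branch_in V (x n)} \<subseteq> insert 0 N" by (auto simp: N_def)
  ultimately show False using infinite_branches finite_subset by blast
qed

lemma W_V: "W n \<subseteq> V"
  using H_V xV by (auto simp: W_def)

lemma x_in_W: "x i \<in> W n"
  using x_in_H[of i n] by (cases "i < n") (auto simp: W_def)

lemma H_W: "n \<le> m \<Longrightarrow> H m \<subseteq> W n"
  using H_mono by (auto simp: W_def)

lemma W_antimono: "n \<le> m \<Longrightarrow> W m \<subseteq> W n"
  using H_W x_in_W by (auto simp: W_def[of m])

lemma tree_W: "rooted_subtree (x n) (W n)"
  unfolding rooted_subtree_def
proof (intro conjI ballI impI)
  show "x n \<in> W n" by (rule x_in_W)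
  show "W n \<subseteq> V" by (rule W_V)
  fix v assume "v \<in> W n" "v \<noteq> x n"
  then consider "v \<in> H n" | i where "v = x i" "i < n" unfolding W_def by blast
  thus "\<exists>w \<in> W n. adj w v \<and> d (x n) w < d (x n) v"
  proof cases
    case 1
    thus ?thesis using cone_rooted_subtree[OF xV[of 0] xV[of n]] \<open>v \<noteq> x n\<close>
      unfolding rooted_subtree_def W_def by blast
  next
    case 2
    have "d (x n) (x (Suc i)) < d (x n) (x i)"
      using ray_dist_le[OF x, of "Suc i" n] ray_dist_le[OF x, of i n] 2(2) d_sym[of "x n"] by simp
    thus ?thesis using 2 x_adj x_in_W by blast
  qed
qed

lemma W_sibling: "induce G (W n) \<in> sibling_trees G"
  using sibling_if_cone_subset[OF tree_W, of n n] H_W[of n n] by simp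

text \<open>Vertices of \<open>H n\<close> have distance at least \<open>n\<close> from
  \<open>x 0\<close>, with equality only for \<open>x n\<close>.\<close>

lemma near_x0_in_W: "u \<in> W n \<Longrightarrow> d (x 0) u \<le> n \<Longrightarrow> u = x (d (x 0) u)"
proof -
  assume u: "u \<in> W n" "d (x 0) u \<le> n"
  consider "u \<in> H n" | i where "u = x i" using u(1) by (auto simp: W_def)
  thus ?thesis
  proof cases
    case 1
    hence "d (x 0) u = n + d (x n) u" "u \<in> V" by (auto simp: in_H)
    moreover from this have "d (x n) u = 0" using u(2) by simp
    ultimately show ?thesis using d_eq_0[OF xV, of u n] by auto
  qed (simp add: d0)
qed

lemma neighbours_before:
  assumes "s < n" "u \<in> W n" "adj (x s) u"
  shows "u = x (Suc s) \<or> (0 < s \<and> u = x (s - 1))"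
proof -
  have "d (x 0) u = Suc s \<or> s = Suc (d (x 0) u)"
    using adj_level[OF xV assms(3), of 0] d0 by simp
  moreover have "u = x (d (x 0) u)" using near_x0_in_W[OF assms(2)] calculation assms(1) by auto
  ultimately show ?thesis by auto
qed

lemma no_branch_before: "s < n \<Longrightarrow> \<not> branch_in (W n) (x s)"
  using neighbours_before[of s n] unfolding branch_in_def by metis

lemma x0_leaf: "0 < n \<Longrightarrow> leaf_in (W n) (x 0)"
  using neighbours_before[of 0 n] unfolding leaf_in_def by blast

lemma x_no_leaf: "0 < i \<Longrightarrow> \<not> leaf_in (W n) (x i)"
  using x_in_W[of "i - 1" n] x_in_W[of "Suc i" n] x_adj(2)[of "i - 1"] x_adj(1)[of i] x_eq[of "i - 1" "Suc i"]
  unfolding leaf_in_def by auto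

text \<open>Nothing is cut off at the ray from \<open>x n\<close> on: a child of \<open>x i\<close>
  lies in \<open>H i\<close>, and its parent is on the ray.\<close>

lemma neighbour_x_in_W:
  assumes "0 < n" "n \<le> i" "adj (x i) u"
  shows "u \<in> W n"
proof (cases "d (x 0) u = Suc i")
  case True
  hence "u \<in> H i" using cone_up[OF xV xV cone_self[OF xV] assms(3)] d0 by simp
  thus ?thesis using H_W[OF assms(2)] by blast
next
  case False
  hence du: "i = Suc (d (x 0) u)" using adj_level[OF xV assms(3), of 0] d0 by simp
  obtain j where j: "i = Suc j" using assms by (cases i) auto
  have "u = x j"
    by (rule pred_unique[OF xV[of 0] adj_sym[OF assms(3)]]) (use x_adj j du d0 in auto)
  thus ?thesis using x_in_W by simp
qed

lemma branch_in_W: "\<lbrakk>0 < n; n \<le> i; branch_in V (x i)\<rbrakk> \<Longrightarrow> branch_in (W n) (x i)"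
  using neighbour_x_in_W unfolding branch_in_def by blast

lemma neighbour_H_in_W:
  assumes "v \<in> H n" "v \<noteq> x n" "adj v u"
  shows "u \<in> W n"
  using cone_neighbour[OF xV xV assms] H_W[of n n] by blast

text \<open>The later cut removes a third neighbour of the branch vertex \<open>x n\<close>.\<close>

lemma W_psubset:
  assumes n: "n \<in> N" and "n < m"
  shows "W m \<subset> W n"
proof -
  have n0: "0 < n" "branch_in V (x n)" using n by (auto simp: N_def)
  then obtain j where j: "n = Suc j" by (cases n) auto
  obtain z where z: "adj (x n) z" "z \<noteq> x j" "z \<noteq> x (Suc n)"
    using branch_in_avoid[OF n0(2)] by metis
  have dz: "d (x 0) z = Suc n"
    using level_step[OF xV x_adj(1)[of j], of z 0] z(1,2) j d0 by auto
  have "z \<notin> W m"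
  proof
    assume "z \<in> W m"
    hence "z = x (d (x 0) z)" by (rule near_x0_in_W) (use dz assms in simp)
    thus False using dz z(3) by simp
  qed
  moreover have "z \<in> W n" using neighbour_x_in_W[OF n0(1) _ z(1)] by simp
  ultimately show ?thesis using W_antimono[of n m] assms(2) by auto
qed

text \<open>An isomorphism preserves the only end whose rays have infinitely many branch vertices.\<close>

lemma iso_shift:
  assumes n: "0 < n" and h: "subtree_iso (W n) (W m) h"
  obtains a b where "\<And>i. h (x (b + i)) = x (a + i)"
proof -
  have inj: "inj_on h (W n)" and im: "h ` W n = W m"
    and adj: "\<And>u v. u \<in> W n \<Longrightarrow> v \<in> W n \<Longrightarrow> adj (h u) (h v) \<longleftrightarrow> adj u v"
    using h by (auto simp: subtree_iso_def bij_betw_def)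
  have "nb_ray G (h \<circ> x)"
    unfolding nb_ray_def using adj x_in_W x_adj inj x_eq by (auto simp: inj_on_eq_iff)
  \<comment> \<open>The image of the ray is rerooted at \<open>x 0\<close>, where
    \<open>single\<close> can be applied.\<close>
  then obtain y where y: "nb_ray G y" "y 0 = x 0" and eq: "tail_equiv (h \<circ> x) y"
    using ray_reroot[OF _ xV] by metis
  obtain a b where ab: "\<And>i. h (x (b + i)) = y (a + i)"
    using eq by (auto simp: tail_equiv_def)
  have "branch_in V (y (a + i))" if "branch_in V (x (b + i))" "n \<le> b + i" for i
    using branch_in_iso[OF h x_in_W branch_in_W[OF n that(2,1)]] branch_in_mono[OF _ W_V] ab by metis
  hence sub: "{j. branch_in V (x j)} \<subseteq> {..n + b} \<union> (\<lambda>j. b + (j - a)) ` {j. branch_in V (y j)}"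
  proof (intro subsetI)
    fix j assume *: "j \<in> {j. branch_in V (x j)}"
    show "j \<in> {..n + b} \<union> (\<lambda>j. b + (j - a)) ` {j. branch_in V (y j)}"
    proof (cases "j \<le> n + b")
      case False
      then obtain i where i: "j = b + i" "n \<le> b + i" using le_Suc_ex[of b j] by auto
      hence "branch_in V (y (a + i))"
        using * \<open>\<And>i. branch_in V (x (b + i)) \<Longrightarrow> n \<le> b + i \<Longrightarrow> branch_in V (y (a + i))\<close> by simp
      thus ?thesis using i by (intro UnI2 image_eqI[of _ _ "a + i"]) auto
    qed simp
  qed
  have "infinite {j. branch_in V (y j)}"
  proof
    assume "finite {j. branch_in V (y j)}"
    hence "finite ({..n + b} \<union> (\<lambda>j. b + (j - a)) ` {j. branch_in V (y j)})" by simp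
    thus False using sub infinite_branches finite_subset by blast
  qed
  hence "y = x" using single y by blast
  thus ?thesis using that ab by blast
qed

text \<open>The side tree at \<open>x i\<close>, including \<open>x i\<close> itself.\<close>

abbreviation B :: "nat \<Rightarrow> 'a set" where
  "B i \<equiv> H i - H (Suc i)"

text \<open>Koenig's argument: infinitely many leaves in \<open>B i\<close> would give a ray into \<open>B i\<close> all of whose cones contain
  infinitely many of these leaves, so with infinitely many branch vertices.\<close>

lemma finite_leaves: "finite {v \<in> B i. leaf_in V v}"
proof (rule ccontr)
  assume inf: "infinite {v \<in> B i. leaf_in V v}"
  define L where "L v = {u \<in> cone (x 0) v. u \<notin> H (Suc i) \<and> leaf_in V u}" for v
  \<comment> \<open>By local finiteness one of the finitely many children inherits infinitely many
    leaves.\<close>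
  have step: "\<exists>c. adj v c \<and> d (x 0) c = Suc (d (x 0) v) \<and> infinite (L c)"
    if v: "v \<in> V" "infinite (L v)" for v
  proof (rule ccontr)
    assume no: "\<not> ?thesis"
    define C where "C = {c. adj v c \<and> d (x 0) c = Suc (d (x 0) v)}"
    have "C \<subseteq> {c. adj v c}" by (auto simp: C_def)
    hence "finite C" using lf v(1) finite_subset unfolding locally_finite_def by blast
    moreover have "finite (L c)" if "c \<in> C" for c using no that by (auto simp: C_def)
    ultimately have "finite ({v} \<union> (\<Union>c \<in> C. L c))" by simp
    moreover have "L v \<subseteq> {v} \<union> (\<Union>c \<in> C. L c)"
    proof
      fix u assume u: "u \<in> L v"
      show "u \<in> {v} \<union> (\<Union>c \<in> C. L c)"
      proof (cases "u = v")
        case False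
        then obtain c where "adj v c" "d (x 0) c = Suc (d (x 0) v)" "u \<in> cone (x 0) c"
          using cone_child[OF xV[of 0] v(1)] u unfolding L_def by blast
        thus ?thesis using u by (auto simp: C_def L_def)
      qed simp
    qed
    ultimately show False using v(2) finite_subset by blast
  qed
  define g where "g v = (SOME c. adj v c \<and> d (x 0) c = Suc (d (x 0) v) \<and> infinite (L c))" for v
  have g: "adj v (g v) \<and> d (x 0) (g v) = Suc (d (x 0) v) \<and> infinite (L (g v))"
    if "v \<in> V" "infinite (L v)" for v
    unfolding g_def using step[OF that] by (rule someI_ex)
  define q where "q t = (g ^^ t) (x i)" for t
  have qS: "q (Suc t) = g (q t)" for t by (simp add: q_def)
  have q: "q t \<in> V \<and> infinite (L (q t)) \<and> d (x 0) (q t) = i + t" for t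
  proof (induction t)
    case 0
    have "L (x i) = {v \<in> B i. leaf_in V v}" by (auto simp: L_def)
    thus ?case using inf xV d0 by (simp add: q_def)
  next
    case (Suc t)
    hence "adj (q t) (g (q t)) \<and> d (x 0) (g (q t)) = Suc (d (x 0) (q t)) \<and> infinite (L (g (q t)))"
      using g by blast
    thus ?case using Suc adj_in_V(2) unfolding qS by auto
  qed
  have q_adj: "adj (q t) (q (Suc t))" for t using g q unfolding qS by blast
  \<comment> \<open>The branch found is preceded by the path from \<open>x 0\<close> to
    \<open>x i\<close>, because \<open>single\<close> speaks of rays from
    \<open>x 0\<close>.\<close>
  define y where "y t = (if t \<le> i then x t else q (t - i))" for t
  have y_q: "y (i + t) = q t" for t by (auto simp: y_def q_def)
  have dy: "d (x 0) (y t) = t" for t using d0 q[of "t - i"] by (auto simp: y_def)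
  have y_adj: "adj (y t) (y (Suc t))" for t
  proof (cases "t < i")
    case True
    thus ?thesis using x_adj by (simp add: y_def)
  next
    case False
    then obtain l where "t = i + l" using le_Suc_ex not_less by metis
    thus ?thesis using q_adj[of l] y_q[of l] y_q[of "Suc l"] by simp
  qed
  have y: "nb_ray G y" using ray_from_levels[OF xV[of 0] y_adj dy] .
  have yV: "y t \<in> V" for t using ray_in_V[OF y] .
  \<comment> \<open>So the constructed ray leaves \<open>x\<close> at \<open>x i\<close>.\<close>
  have "L (x (Suc i)) = {}" by (auto simp: L_def)
  hence "q 1 \<noteq> x (Suc i)" using q[of 1] by force
  moreover have "y (Suc i) = q 1" using y_q[of 1] by simp
  ultimately have "y \<noteq> x" by metis
  moreover have "infinite {j. branch_in V (y j)}"
  proof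
    assume "finite {j. branch_in V (y j)}"
    then obtain t0 where "\<forall>t \<in> {j. branch_in V (y j)}. t \<le> t0"
      unfolding finite_nat_set_iff_bounded_le by blast
    hence t0: "t \<le> t0" if "branch_in V (y t)" for t using that by simp
    \<comment> \<open>Beyond its last branch vertex, a cone of \<open>y\<close> contains only
      vertices of \<open>y\<close>, and none of these is a leaf.\<close>
    have along: "u = y (t + s)" if "t0 < t" "u \<in> cone (x 0) (y t)" "d (y t) u = s" for t s u
      using that
    proof (induction s arbitrary: t)
      case 0
      thus ?case using d_eq_0[OF yV, of u t] by (auto simp: cone_def)
    next
      case (Suc s)
      hence "u \<noteq> y t" by auto
      then obtain c where c: "adj (y t) c" "d (x 0) c = Suc (d (x 0) (y t))" "u \<in> cone (x 0) c"
        "d (y t) u = Suc (d c u)"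
        using cone_child[OF xV[of 0] yV Suc.prems(2)] by metis
      obtain t' where t': "t = Suc t'" using Suc.prems(1) by (cases t) auto
      have "c = y (Suc t)"
      proof (rule ccontr)
        assume ne: "c \<noteq> y (Suc t)"
        have "c \<noteq> y t'" using c(2) dy[of t] dy[of t'] t' by auto
        moreover have "y t' \<noteq> y (Suc t)" using y t' by (simp add: nb_ray_def)
        moreover have "adj (y t) (y t')" using adj_sym[OF y_adj[of t']] t' by simp
        ultimately have "branch_in V (y t)"
          using ne c(1) y_adj[of t] yV adj_in_V(2)[OF c(1)]
          by (intro branch_inI[of "y t'" _ "y (Suc t)" c]) auto
        thus False using t0 Suc.prems(1) by fastforce
      qed
      hence "u = y (Suc t + s)" using Suc.IH[of "Suc t"] c Suc.prems by simp
      thus ?case by simp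
    qed
    define t where "t = i + Suc t0"
    have tt: "t0 < t" "0 < t" by (auto simp: t_def)
    have "infinite (L (y t))" using q[of "Suc t0"] y_q[of "Suc t0"] by (simp add: t_def)
    then obtain u where u: "u \<in> L (y t)" using not_finite_existsD by fastforce
    then obtain s where "u = y (t + s)" using along[OF tt(1)] unfolding L_def by blast
    moreover obtain j where j: "t + s = Suc j" using tt by (cases "t + s") auto
    ultimately have "leaf_in V (y (Suc j))" using u by (simp add: L_def)
    moreover have "adj (y (Suc j)) (y j)" using adj_sym[OF y_adj] .
    ultimately have "y j = y (Suc (Suc j))"
      using y_adj[of "Suc j"] yV unfolding leaf_in_def by blast
    thus False using y by (simp add: nb_ray_def)
  qed
  moreover have "y 0 = x 0" by (simp add: y_def q_def)
  ultimately show False using single y by blast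
qed

text \<open>The preimage \<open>u\<close> of \<open>v\<close> has the same distances to the shifted
  ray, so by \<open>in_H_Suc\<close> it lies in the corresponding side tree. None of its neighbours
  is cut off, so it is a leaf of \<open>G\<close>. The \<open>Suc\<close> leaves room for the
  preceding ray vertex in \<open>in_H_Suc\<close>.\<close>

lemma leaf_depth_shift:
  assumes n: "0 < n" and h: "subtree_iso (W n) (W m) h" and hx: "\<And>i. h (x (b + i)) = x (a + i)"
    and "n \<le> b" "m \<le> a"
    and bound: "\<And>u. u \<in> B (Suc b + i) \<Longrightarrow> leaf_in V u \<Longrightarrow> d u (x (Suc b + i)) \<le> M"
    and v: "v \<in> B (Suc a + i)" "leaf_in V v"
  shows "d v (x (Suc a + i)) \<le> M"
proof -
  have im: "h ` W n = W m" and inj: "inj_on h (W n)"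
    using h by (auto simp: subtree_iso_def bij_betw_def)
  have dist: "d (h p) (h q) = d p q" if "p \<in> W n" "q \<in> W n" for p q
    using subtree_iso_dist[OF tree_W W_V h that] .
  have "v \<in> W m" using v(1) H_W[of m "Suc a + i"] assms(5) by auto
  then obtain u where u: "u \<in> W n" "v = h u" using im by blast
  have uV: "u \<in> V" and vV: "v \<in> V" using u W_V v(1) H_V by blast+
  have dx: "d v (x (a + j)) = d u (x (b + j))" for j
    using dist[OF u(1) x_in_W, of "b + j"] u(2) hx by simp
  have v1: "d v (x (a + i)) = Suc (d v (x (Suc (a + i))))"
    "d v (x (Suc (a + i))) \<noteq> Suc (d v (x (Suc (Suc (a + i)))))"
    using v(1) in_H_Suc[OF vV] by auto
  have uB: "u \<in> B (Suc b + i)"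
    using v1 dx[of i] dx[of "Suc i"] dx[of "Suc (Suc i)"] in_H_Suc[OF uV, of "b + i"]
      in_H_Suc[OF uV, of "Suc (b + i)"] by simp
  have uH: "u \<in> H n" using uB H_mono[of n "Suc b + i"] assms(4) by auto
  have "u \<noteq> x n" using uB x_in_H[of n "Suc b + i"] assms(4) by auto
  hence nbr: "w \<in> W n" if "adj u w" for w using neighbour_H_in_W[OF uH _ that] by blast
  have "leaf_in (W n) u"
    by (rule leaf_in_iso[OF h u(1)]) (use v(2) u(2) W_V in \<open>auto simp: leaf_in_def\<close>)
  hence "leaf_in V u" using nbr unfolding leaf_in_def by blast
  hence "d u (x (Suc b + i)) \<le> M" using bound uB by blast
  thus ?thesis using dx[of "Suc i"] by simp
qed

text \<open>A bound for the side tree at one index carries over to the index \<open>a - b\<close>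
  further on. Hence the maximum over finitely many initial side trees bounds all.\<close>

lemma bounded_leaf_depth:
  assumes n: "0 < n" and h: "subtree_iso (W n) (W m) h" and hx: "\<And>i. h (x (b + i)) = x (a + i)"
    and "b < a"
  shows "\<exists>M. \<forall>i. \<forall>v \<in> B i. leaf_in V v \<longrightarrow> d v (x i) \<le> M"
proof -
  \<comment> \<open>The shift \<open>e\<close> is applied from \<open>c\<close> on, past
    \<open>b\<close> and both cuts.\<close>
  define c e where "c = b + n + m" and "e = a - b"
  have hc: "h (x (c + i)) = x (c + e + i)" for i
    using hx[of "n + m + i"] assms(4) by (simp add: c_def e_def algebra_simps)
  have e: "0 < e" using assms(4) by (simp add: e_def)
  have "\<exists>M. \<forall>v \<in> B i. leaf_in V v \<longrightarrow> d v (x i) \<le> M" for i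
  proof -
    have "finite ((\<lambda>v. d v (x i)) ` {v \<in> B i. leaf_in V v})" using finite_leaves by blast
    then obtain M where "\<forall>k \<in> (\<lambda>v. d v (x i)) ` {v \<in> B i. leaf_in V v}. k \<le> M"
      unfolding finite_nat_set_iff_bounded_le by blast
    thus ?thesis by auto
  qed
  then obtain M where M: "\<And>i v. v \<in> B i \<Longrightarrow> leaf_in V v \<Longrightarrow> d v (x i) \<le> M i" by metis
  define K where "K = Max (M ` {..c + e})"
  have K: "M i \<le> K" if "i \<le> c + e" for i using that by (auto simp: K_def)
  have "\<forall>v \<in> B i. leaf_in V v \<longrightarrow> d v (x i) \<le> K" for i
  proof (induction i rule: less_induct)
    case (less i)
    show ?case
    proof (cases "i \<le> c + e")
      case True
      thus ?thesis using M[of _ i] K[OF True] order_trans by blast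
    next
      case False
      then obtain l where l: "i = Suc (c + e) + l" using le_Suc_ex[of "Suc (c + e)" i] by auto
      have IH: "d u (x (Suc c + l)) \<le> K" if "u \<in> B (Suc c + l)" "leaf_in V u" for u
        using less[of "Suc c + l"] that l e by auto
      show ?thesis
      proof (intro ballI impI)
        fix v assume v: "v \<in> B i" "leaf_in V v"
        show "d v (x i) \<le> K"
          using leaf_depth_shift[OF n h hc _ _ IH] v l by (simp add: c_def)
      qed
    qed
  qed
  thus ?thesis by blast
qed

text \<open>A shift in either direction gives the bound, through \<open>h\<close> or its inverse.
  Without a shift \<open>h\<close> fixes a vertex of the ray, which is impossible as
  \<open>W m\<close> is a proper subset of \<open>W n\<close>.\<close>

lemma bounded_leaf_depth_if_iso:
  assumes n: "n \<in> N" and m: "m \<in> N" and "n < m" and h: "subtree_iso (W n) (W m) h"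
  shows "\<exists>M. \<forall>i. \<forall>v \<in> B i. leaf_in V v \<longrightarrow> d v (x i) \<le> M"
proof -
  have pos: "0 < n" "0 < m" using n m by (auto simp: N_def)
  obtain a b where ab: "\<And>i. h (x (b + i)) = x (a + i)" using iso_shift[OF pos(1) h] by blast
  consider "b < a" | "a < b" | "a = b" by linarith
  thus ?thesis
  proof cases
    case 1
    thus ?thesis using bounded_leaf_depth[OF pos(1) h ab] by blast
  next
    case 2
    have "inv_into (W n) h (x (a + i)) = x (b + i)" for i
      using h x_in_W ab[of i, symmetric] by (simp add: subtree_iso_def bij_betw_def)
    thus ?thesis using bounded_leaf_depth[OF pos(2) subtree_iso_inv[OF h]] 2 by blast
  next
    case 3
    have "W m = W n"
      using self_embedding_fixing_vertex[OF lf tree_W h _ x_in_W, of b] ab[of 0] 3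
        W_psubset[OF n assms(3)] by auto
    thus ?thesis using W_psubset[OF n assms(3)] by blast
  qed
qed

text \<open>The path before \<open>x m\<close> makes \<open>x 0\<close> a leaf of \<open>W m\<close> whose nearest branch vertex has distance \<open>m\<close>.\<close>

lemma no_iso_beyond_leaf_depth:
  assumes n: "n \<in> N" and m: "m \<in> N" and "n < m" "M < m" and h: "subtree_iso (W n) (W m) h"
    and M: "\<And>i v. v \<in> B i \<Longrightarrow> leaf_in V v \<Longrightarrow> d v (x i) \<le> M"
  shows False
proof -
  have n0: "0 < n" "branch_in V (x n)" using n by (auto simp: N_def)
  have im: "h ` W n = W m" using h by (auto simp: subtree_iso_def bij_betw_def)
  have dist: "d (h p) (h q) = d p q" if "p \<in> W n" "q \<in> W n" for p q
    using subtree_iso_dist[OF tree_W W_V h that] .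
  obtain v where v: "v \<in> W n" "h v = x 0" using im x_in_W[of 0 m] by (metis imageE)
  have leaf: "leaf_in (W n) v" using leaf_in_iso[OF h v(1)] v(2) x0_leaf[of m] assms(3) by simp
  \<comment> \<open>Up to distance \<open>m\<close> from \<open>x 0\<close>, the tree
    \<open>W m\<close> is a bare path.\<close>
  have far: "m \<le> d v w" if "w \<in> W n" "branch_in (W n) w" for w
  proof (rule ccontr)
    assume "\<not> m \<le> d v w"
    hence lt: "d (x 0) (h w) < m" using dist[OF v(1) that(1)] v(2) by simp
    moreover have "h w \<in> W m" using im that by blast
    ultimately have "h w = x (d (x 0) (h w))" using near_x0_in_W[of "h w" m] by simp
    thus False using no_branch_before[OF lt] branch_in_iso[OF h that] by simp
  qed
  show False
  proof (cases "v \<in> H n")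
    case True
    have "v \<noteq> x n" using leaf x_no_leaf[OF n0(1)] by blast
    hence leafV: "leaf_in V v" using leaf neighbour_H_in_W[OF True] unfolding leaf_in_def by blast
    have vV: "v \<in> V" using True H_V by blast
    \<comment> \<open>The index of the side tree that contains \<open>v\<close>.\<close>
    define j where "j = (LEAST j. v \<notin> H (Suc j))"
    have "v \<notin> H (Suc (d (x 0) v))" by (simp add: in_H)
    hence j: "v \<notin> H (Suc j)" unfolding j_def by (rule LeastI)
    have nj: "n \<le> j"
    proof (rule ccontr)
      assume "\<not> n \<le> j"
      thus False using j True H_mono[of "Suc j" n] by auto
    qed
    have vj: "v \<in> H j"
    proof (cases j)
      case 0
      thus ?thesis using nj n0 by simp
    next
      case (Suc l)
      thus ?thesis using not_less_Least[of l "\<lambda>j. v \<notin> H (Suc j)"] unfolding j_def[symmetric] by auto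
    qed
    have "v \<noteq> x j" using leaf x_no_leaf[of j] nj n0 by auto
    then obtain c where c: "adj (x j) c" "d (x 0) c = Suc (d (x 0) (x j))" "v \<in> cone (x 0) c"
      using cone_child[OF xV[of 0] xV vj] by metis
    obtain l where l: "j = Suc l" using nj n0 by (cases j) auto
    have "c \<noteq> x (Suc j)" using c(3) j by auto
    moreover have "c \<noteq> x l" using c(2) d0 l by auto
    moreover have "c \<in> W n" using neighbour_x_in_W[OF n0(1) nj c(1)] .
    \<comment> \<open>The step from \<open>x j\<close> towards \<open>v\<close> leaves the ray, so
      \<open>x j\<close> is a branch vertex at distance at most \<open>M\<close> from
      \<open>v\<close>.\<close>
    ultimately have "branch_in (W n) (x j)"
      using c(1) x_adj l x_in_W x_eq by (intro branch_inI[of "x l" _ "x (Suc j)" c]) auto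
    hence "m \<le> d v (x j)" using far x_in_W by blast
    moreover have "d v (x j) \<le> M" using M[OF _ leafV] vj j by blast
    ultimately show False using assms(4) by simp
  next
    case False
    \<comment> \<open>Here \<open>v\<close> is the leaf \<open>x 0\<close> of \<open>W n\<close>,
      whose distance to the branch vertex \<open>x n\<close> is only \<open>n\<close>.\<close>
    then obtain i where i: "v = x i" using v(1) by (auto simp: W_def)
    hence "i = 0" using leaf x_no_leaf[of i] by auto
    moreover have "m \<le> d v (x n)" using far[OF x_in_W branch_in_W[OF n0(1) _ n0(2)]] by simp
    ultimately show False using i d0 assms(3) by simp
  qed
qed

lemma iso_pair:
  assumes "Sib G \<noteq> \<infinity>" "infinite I" "I \<subseteq> N"
  obtains n m h where "n \<in> I" "m \<in> I" "n < m" "subtree_iso (W n) (W m) h"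
proof -
  have "\<exists>i \<in> I. infinite {j \<in> I.
      digraph_iso (with_proj (induce G (W i))) (with_proj (induce G (W j)))}"
    by (rule infinitely_many_isomorphic[OF assms(1) W_sibling assms(2)])
  then obtain i where i: "i \<in> I"
    "infinite {j \<in> I. digraph_iso (with_proj (induce G (W i))) (with_proj (induce G (W j)))}"
    by (rule bexE)
  then obtain j where j: "j > i" "j \<in> I"
    "digraph_iso (with_proj (induce G (W i))) (with_proj (induce G (W j)))"
    using i(2) unfolding infinite_nat_iff_unbounded by blast
  obtain h where "subtree_iso (W i) (W j) h" using subtree_isoI[OF j(3)] .
  thus ?thesis using that i(1) j by blast
qed

text \<open>The pigeonhole principle is used twice: one isomorphic pair yields the bound
  \<open>M\<close> on leaf depths, and a second pair with indices beyond \<open>M\<close>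
  contradicts it.\<close>

lemma infinitely_many_siblings: "Sib G = \<infinity>"
proof (rule ccontr)
  assume fin: "Sib G \<noteq> \<infinity>"
  obtain n m h where "n \<in> N" "m \<in> N" "n < m" "subtree_iso (W n) (W m) h"
    using iso_pair[OF fin infinite_N] by blast
  then obtain M where M: "\<And>i v. v \<in> B i \<Longrightarrow> leaf_in V v \<Longrightarrow> d v (x i) \<le> M"
    using bounded_leaf_depth_if_iso by metis
  have "N \<subseteq> {n \<in> N. M < n} \<union> {..M}" by auto
  hence "infinite {n \<in> N. M < n}" using infinite_N finite_subset by (metis finite_UnI finite_atMost)
  then obtain n m h where "n \<in> {n \<in> N. M < n}" "m \<in> {n \<in> N. M < n}" "n < m"
    "subtree_iso (W n) (W m) h"
    using iso_pair[OF fin, of "{n \<in> N. M < n}"] by blast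
  thus False using no_iso_beyond_leaf_depth[of n m M h] M by blast
qed

end

theorem theorem3p11:
  fixes T :: "'a pair_pre_digraph"
  assumes "tree_graph T"
    and "locally_finite T"
    and "\<exists>f. parabolic_embedding T f"
    and "\<not> ray T"
  shows "Sib T = \<infinity>"
proof -
  obtain x where "pushed_tree T x" using parabolic_pushed_tree assms by metis
  then interpret pushed_tree T x .
  show ?thesis
  proof (cases "\<exists>y. nb_ray T y \<and> y 0 = x 0 \<and> infinite {j. branch_in V (y j)} \<and> y \<noteq> x")
    case True
    thus ?thesis using second_branching_ray by blast
  next
    case False
    then interpret single_branching_ray T x by unfold_locales blast
    show ?thesis by (rule infinitely_many_siblings)
  qed
qed

end
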